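(* Let $w\in\widetilde{S_n}$ and let $(P,Q,\rho)$ be its image under AMBC, with $P,Q$ of shape $\lambda$. Then \[\operatorname{sgn}(w)\cdot(-1)^{\sum_{i=1}^n (w(i)-i)}=(-1)^{\operatorname{inv}(P)+\operatorname{inv}(Q)+\operatorname{inv}(\lambda)+\operatorname{inv}_\lambda(\rho)}.\]
   Context: Fix $n\ge1$. For $i\in\mathbb Z$ write $\overline{i}=i+n\mathbb Z$, $[\overline n]=\{\overline 1,\dots,\overline n\}$. $\widetilde{S_n}$ is the set of bijections $w:\mathbb Z\to\mathbb Z$ with $w(i+n)=w(i)+n$; more generally a partial permutation is an injection $w:U\to\mathbb Z$ with $U\subseteq\mathbb Z$ stable under $x\mapsto x\pm n$ and $w(i+n)=w(i)+n$. The balls of $w$ are the points $(i,w(i))$ (first coordinate = row, increasing southward; second = column, increasing eastward). A cell $(i,j)$ is northwest of $(i',j')$ if $i\le i'$, $j\le j'$ (strictly if both strict), northeast if $i\le i'$, $j\ge j'$, southwest if $i\ge i'$, $j\le j'$. Translates: images under $(i,j)\mapsto(i+kn,j+kn)$. AMBC. For a nonempty partial permutation $w$: a channel is a set of balls, invariant under translation by $(n,n)$, totally ordered by the northwest order, with maximal number of translation classes among such sets. There is a unique southwest-most channel $C$ (for every channel $C'$, each ball of $C$ is weakly southwest of some ball of $C'$). Number $C$ by consecutive integers $\tilde d$ increasing from northwest to southeast; for each ball $b$ set $d(b)=\max(\tilde d(b_k)+k)$ over sequences of balls $b=b_0,\dots,b_k$ with $b_{t+1}$ strictly northwest of $b_t$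 and $b_k\in C$ (finite). For each $t$, write the balls with $d=t$ as $(i_1,j_1),\dots,(i_s,j_s)$, $i_1<\dots<i_s$ (so $j_1>\dots>j_s$); outer corners are $(i_{r+1},j_r)$, $1\le r<s$; back corner is $(i_1,j_s)$. $\mathrm{fw}(w)$ is the partial permutation whose balls are all outer corners; $S$ is the set of back corners. Record the residues mod $n$ of the column indices of $S$ as the next row of $P$, of the row indices as the next row of $Q$, and $\sum_c(\lceil c_2/n\rceil-\lceil c_1/n\rceil)$ (one representative $c=(c_1,c_2)$ per translation class of $S$) as the next entry of $\rho$; then replace $w$ by $\mathrm{fw}(w)$ and repeat until empty. For $w\in\widetilde{S_n}$, $P,Q$ are tabloids of a common shape $\lambda$, a partition of $n$ ($\lambda_r$ = number of translation classes of back corners at step $r$), each containing every element of $[\overline n]$ once; a tabloid is a sequence of disjoint subsets (rows) of $[\overline n]$, row 1 highest. $\rho\in\mathbb Z^{\ell(\lambda)}$. Sign: the length $\ell(w)$ is the number of translation classes (under simultaneous translation by $(n,n)$) of pairs $(a,b)$ of balls of $w$ with $a$ strictly northeast of $b$; $\operatorname{sgn}(w)=(-1)^{\ell(w)}$. Broken order: the linear order $\overline1<\overline2<\dots<\overline n$ on $[\overline n]$. For a tabloid $T$, $\operatorname{inv}(T)$ is the number of pairs $\overline i<\overline j$ (broken order) such that $\overline i$ is in a strictly lower row of $T$ than $\overline j$. For a partition $\lambda$, $\operatorname{inv}(\lambda)=\lambda_2+\lambda_4+\lambda_6+\cdots$. For $\rho\in\mathbb Z^{\ell(\lambda)}$,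 $\operatorname{inv}_\lambda(\rho)=\sum_{i:\ \lambda_i \text{ odd}}\rho_i$. *)

theory Defs
  imports Complex_Main
begin

type_synonym ball = "int \<times> int"

definition tshift :: "nat \<Rightarrow> int \<Rightarrow> ball \<Rightarrow> ball" where
  "tshift n k b = (fst b + k * int n, snd b + k * int n)"

definition tshift2 :: "nat \<Rightarrow> int \<Rightarrow> ball \<times> ball \<Rightarrow> ball \<times> ball" where
  "tshift2 n k p = (tshift n k (fst p), tshift n k (snd p))"

definition tclasses :: "(int \<Rightarrow> 'a \<Rightarrow> 'a) \<Rightarrow> 'a set \<Rightarrow> 'a set set" where
  "tclasses sh X = (\<lambda>x. {y \<in> X. \<exists>k. y = sh k x}) ` X"

definition ncls :: "nat \<Rightarrow> ball set \<Rightarrow> nat" where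
  "ncls n X = card (tclasses (tshift n) X)"

definition tinv :: "nat \<Rightarrow> ball set \<Rightarrow> bool" where
  "tinv n X \<longleftrightarrow> (\<forall>x\<in>X. \<forall>k. tshift n k x \<in> X)"

definition wNW :: "ball \<Rightarrow> ball \<Rightarrow> bool" where
  "wNW a b \<longleftrightarrow> fst a \<le> fst b \<and> snd a \<le> snd b"

definition sNW :: "ball \<Rightarrow> ball \<Rightarrow> bool" where
  "sNW a b \<longleftrightarrow> fst a < fst b \<and> snd a < snd b"

definition sNE :: "ball \<Rightarrow> ball \<Rightarrow> bool" where
  "sNE a b \<longleftrightarrow> fst a < fst b \<and> snd a > snd b"

definition wSW :: "ball \<Rightarrow> ball \<Rightarrow> bool" where
  "wSW a b \<longleftrightarrow> fst a \<ge> fst b \<and> snd a \<le> snd b"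

definition chainset :: "nat \<Rightarrow> ball set \<Rightarrow> ball set \<Rightarrow> bool" where
  "chainset n B C \<longleftrightarrow> C \<subseteq> B \<and> tinv n C \<and> (\<forall>a\<in>C. \<forall>b\<in>C. wNW a b \<or> wNW b a)"

definition is_channel :: "nat \<Rightarrow> ball set \<Rightarrow> ball set \<Rightarrow> bool" where
  "is_channel n B C \<longleftrightarrow> chainset n B C \<and> (\<forall>C'. chainset n B C' \<longrightarrow> ncls n C' \<le> ncls n C)"

definition sw_channel :: "nat \<Rightarrow> ball set \<Rightarrow> ball set" where
  "sw_channel n B = (THE C. is_channel n B C \<and>
     (\<forall>C'. is_channel n B C' \<longrightarrow> (\<forall>b\<in>C. \<exists>b'\<in>C'. wSW b b')))"

definition chan_num :: "nat \<Rightarrow> ball set \<Rightarrow> ball \<Rightarrow> int" where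
  "chan_num n B = (SOME f. bij_betw f (sw_channel n B) (UNIV :: int set) \<and>
      (\<forall>a\<in>sw_channel n B. \<forall>b\<in>sw_channel n B. a \<noteq> b \<and> wNW a b \<longrightarrow> f a < f b))"

definition dval :: "nat \<Rightarrow> ball set \<Rightarrow> ball \<Rightarrow> int" where
  "dval n B b = (GREATEST v. \<exists>bs. bs \<noteq> [] \<and> hd bs = b \<and> set bs \<subseteq> B \<and>
      last bs \<in> sw_channel n B \<and>
      (\<forall>i. i + 1 < length bs \<longrightarrow> sNW (bs ! (i + 1)) (bs ! i)) \<and>
      v = chan_num n B (last bs) + int (length bs - 1))"

definition level :: "nat \<Rightarrow> ball set \<Rightarrow> int \<Rightarrow> ball set" where
  "level n B t = {b \<in> B. dval n B b = t}"

definition outer_corners :: "ball set \<Rightarrow> ball set" where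
  "outer_corners D = {(fst a', snd a) | a a'. a \<in> D \<and> a' \<in> D \<and> fst a < fst a' \<and>
      \<not> (\<exists>c\<in>D. fst a < fst c \<and> fst c < fst a')}"

definition back_corner :: "ball set \<Rightarrow> ball" where
  "back_corner D = (Min (fst ` D), snd (THE b. b \<in> D \<and> fst b = Max (fst ` D)))"

definition fw :: "nat \<Rightarrow> ball set \<Rightarrow> ball set" where
  "fw n B = (\<Union>t. outer_corners (level n B t))"

definition backS :: "nat \<Rightarrow> ball set \<Rightarrow> ball set" where
  "backS n B = {back_corner (level n B t) | t. level n B t \<noteq> {}}"

text \<open>Residue classes of [n] are represented by the representatives 1..n;
  the broken order is then the usual order.\<close>
definition resid :: "nat \<Rightarrow> int \<Rightarrow> int" where
  "resid n i = (i - 1) mod int n + 1"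

definition ceil_div :: "nat \<Rightarrow> int \<Rightarrow> int" where
  "ceil_div n c = \<lceil>real_of_int c / real n\<rceil>"

definition rho_entry :: "nat \<Rightarrow> ball set \<Rightarrow> int" where
  "rho_entry n S = (\<Sum>K\<in>tclasses (tshift n) S.
      (let c = (SOME c. c \<in> K) in ceil_div n (snd c) - ceil_div n (fst c)))"

definition ambc_iter :: "nat \<Rightarrow> ball set \<Rightarrow> nat \<Rightarrow> ball set" where
  "ambc_iter n B k = (fw n ^^ k) B"

definition ambc_len :: "nat \<Rightarrow> ball set \<Rightarrow> nat" where
  "ambc_len n B = (LEAST k. ambc_iter n B k = {})"

definition ambc_P :: "nat \<Rightarrow> ball set \<Rightarrow> int set list" where
  "ambc_P n B = map (\<lambda>k. (\<lambda>c. resid n (snd c)) ` backS n (ambc_iter n B k)) [0..<ambc_len n B]"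

definition ambc_Q :: "nat \<Rightarrow> ball set \<Rightarrow> int set list" where
  "ambc_Q n B = map (\<lambda>k. (\<lambda>c. resid n (fst c)) ` backS n (ambc_iter n B k)) [0..<ambc_len n B]"

definition ambc_rho :: "nat \<Rightarrow> ball set \<Rightarrow> int list" where
  "ambc_rho n B = map (\<lambda>k. rho_entry n (backS n (ambc_iter n B k))) [0..<ambc_len n B]"

definition ambc_shape :: "nat \<Rightarrow> ball set \<Rightarrow> nat list" where
  "ambc_shape n B = map (\<lambda>k. ncls n (backS n (ambc_iter n B k))) [0..<ambc_len n B]"

definition affine_perm :: "nat \<Rightarrow> (int \<Rightarrow> int) \<Rightarrow> bool" where
  "affine_perm n w \<longleftrightarrow> bij w \<and> (\<forall>i. w (i + int n) = w i + int n)"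

definition balls :: "(int \<Rightarrow> int) \<Rightarrow> ball set" where
  "balls w = {(i, w i) | i. True}"

definition aff_length :: "nat \<Rightarrow> (int \<Rightarrow> int) \<Rightarrow> nat" where
  "aff_length n w = card (tclasses (tshift2 n)
      {(a, b). a \<in> balls w \<and> b \<in> balls w \<and> sNE a b})"

definition tabloid_inv :: "int set list \<Rightarrow> nat" where
  "tabloid_inv T = card {(i, j). i < j \<and> (\<exists>r s. r < length T \<and> s < length T \<and>
      i \<in> T ! r \<and> j \<in> T ! s \<and> s < r)}"

text \<open>lambda_2 + lambda_4 + ... (1-indexed), i.e. entries at odd 0-based positions.\<close>
definition part_inv :: "nat list \<Rightarrow> nat" where
  "part_inv lam = (\<Sum>r<length lam. if odd r then lam ! r else 0)"

definition rho_inv :: "nat list \<Rightarrow> int list \<Rightarrow> int" where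
  "rho_inv lam rho = (\<Sum>r<length lam. if odd (lam ! r) then rho ! r else 0)"

end

theory Submission
  imports Defs
begin

text \<open>
  For a periodic ball set \<open>B\<close> let \<open>\<epsilon>(B)\<close> be the parity of the inversions of the permutation of residues
  induced by \<open>B\<close>, plus the sum of \<open>\<lceil>j/n\<rceil> - \<lceil>i/n\<rceil>\<close> over representatives \<open>(i, j)\<close> of its balls. Counting affine
  inversions pairwise shows that the left-hand side of the theorem is \<open>\<epsilon>(balls w)\<close>.

  Replacing \<open>B\<close> by \<open>fw B \<union> S\<close>, with \<open>S\<close> the set of back corners, rotates the columns of each level cyclically,
  so it keeps the second summand and changes the inversions by the number of balls minus the number of levels.
  Separating \<open>S\<close> from \<open>fw B\<close> costs the pairs counted by \<open>inv(P)\<close> and \<open>inv(Q)\<close>, and since \<open>S\<close> is a northwest chain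
  without affine inversions, \<open>\<epsilon>(S)\<close> is its size times its entry of \<open>\<rho>\<close>. Induction on the number of balls
  gives the theorem.

  That \<open>fw\<close> is well defined rests on the lattice of channels, which provides the southwest-most one, and on its
  uniqueness for every multiple of the period, which bounds the lengths of paths and makes \<open>d\<close> finite.
\<close>


section \<open>Translation classes and inversions of permutation graphs\<close>

text \<open>Let R be the sum of the block differences \<open>ceil_div n j - ceil_div n i\<close>
  over representatives of N classes of balls. Modulo 2, the affine inversions between two classes
  number the inversion of their residues plus both block differences. Every class lies in N - 1
  pairs, so the total is the inversions of the residues plus (N - 1) R. For w, N = n and the
  displacements sum to n R, which leaves \<epsilon>; for a set without affine inversions, \<epsilon>
  is N R.

  Each step adds to the exponent the number of classes left for the later rows. Over all steps the
  size of row r is counted r - 1 times, which modulo 2 is inv(\<lambda>).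

  The obstacle is the finiteness of d. A path may run through many periods, whereas a channel is
  maximal only among sets invariant under translation by n. A long path closes up to a chain only
  for some period p n, and chains of that period could a priori have more than p times as many
  classes as a channel. Uniqueness of the southwest-most channel of period p n excludes this: its
  translates by n coincide with it, so it already competes at period n.\<close>

definition transversal :: "(int \<Rightarrow> 'a \<Rightarrow> 'a) \<Rightarrow> 'a set \<Rightarrow> 'a set \<Rightarrow> bool" where
  "transversal sh X T \<longleftrightarrow> T \<subseteq> X \<and> (\<forall>x\<in>X. \<exists>k. sh k x \<in> T) \<and>
     (\<forall>x\<in>T. \<forall>k. sh k x \<in> T \<longrightarrow> sh k x = x)"

text \<open>Stated for an arbitrary action of the integers, so that it serves balls
  (\<open>tshift\<close>) as well as pairs of balls (\<open>tshift2\<close>).\<close>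

lemma transversal_bij_tclasses:
  assumes "\<And>x. sh 0 x = x" "\<And>j k x. sh j (sh k x) = sh (j + k) x" "transversal sh X T"
  shows "bij_betw (\<lambda>x. {y \<in> X. \<exists>k. y = sh k x}) T (tclasses sh X)"
proof (rule bij_betw_imageI)
  show "inj_on (\<lambda>x. {y \<in> X. \<exists>k. y = sh k x}) T"
  proof (rule inj_onI)
    fix x y assume xy: "x \<in> T" "y \<in> T"
      and eq: "{z \<in> X. \<exists>k. z = sh k x} = {z \<in> X. \<exists>k. z = sh k y}"
    have "y \<in> {z \<in> X. \<exists>k. z = sh k y}"
      using xy assms(3) by (auto simp: transversal_def intro!: exI[of _ 0] assms(1)[symmetric])
    then obtain k where "y = sh k x" using eq by blast
    then show "x = y" using xy assms(3) unfolding transversal_def by metis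
  qed
next
  have eq: "{z \<in> X. \<exists>j. z = sh j (sh k x)} = {z \<in> X. \<exists>j. z = sh j x}" for k x
  proof -
    have "sh j x = sh (j - k) (sh k x)" for j by (simp add: assms(2))
    then show ?thesis using assms(2) by metis
  qed
  show "(\<lambda>x. {y \<in> X. \<exists>k. y = sh k x}) ` T = tclasses sh X"
  proof
    show "(\<lambda>x. {y \<in> X. \<exists>k. y = sh k x}) ` T \<subseteq> tclasses sh X"
      using assms(3) unfolding tclasses_def transversal_def by blast
    show "tclasses sh X \<subseteq> (\<lambda>x. {y \<in> X. \<exists>k. y = sh k x}) ` T"
    proof
      fix K assume "K \<in> tclasses sh X"
      then obtain x where x: "x \<in> X" "K = {y \<in> X. \<exists>k. y = sh k x}"
        unfolding tclasses_def by blast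
      obtain k where "sh k x \<in> T" using x assms(3) unfolding transversal_def by blast
      then show "K \<in> (\<lambda>x. {y \<in> X. \<exists>k. y = sh k x}) ` T"
        using x eq[of k x] by (intro image_eqI[of _ _ "sh k x"]) auto
    qed
  qed
qed

lemma fst_tshift [simp]: "fst (tshift n k b) = fst b + k * int n"
  and snd_tshift [simp]: "snd (tshift n k b) = snd b + k * int n"
  by (simp_all add: tshift_def)

lemma tshift_0 [simp]: "tshift n 0 b = b"
  by (simp add: tshift_def)

lemma tshift_tshift [simp]: "tshift n j (tshift n k b) = tshift n (j + k) b"
  by (simp add: tshift_def algebra_simps)

lemma tshift_mult: "tshift (p * n) k b = tshift n (k * int p) b"
  by (simp add: tshift_def algebra_simps)

lemma tshift_eq_iff [simp]: "tshift n k a = tshift n k b \<longleftrightarrow> a = b"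
  by (auto simp: tshift_def prod_eq_iff)

lemma ncls_transversal: "transversal (tshift n) X T \<Longrightarrow> ncls n X = card T"
  using bij_betw_same_card[OF transversal_bij_tclasses[of "tshift n" X T]]
  by (simp add: ncls_def)

section \<open>Residues in {1..n} and block numbers\<close>

lemma resid_bounds:
  assumes "n \<ge> 1" shows "1 \<le> resid n i" "resid n i \<le> int n"
proof -
  have "0 \<le> (i - 1) mod int n" "(i - 1) mod int n < int n" using assms by auto
  then show "1 \<le> resid n i" "resid n i \<le> int n" unfolding resid_def by linarith+
qed

lemma ceil_div_eq:
  assumes "n \<ge> 1" shows "ceil_div n c = (c - 1) div int n + 1"
  unfolding ceil_div_def
proof (rule ceiling_unique)
  have n: "real n > 0" using assms by simp
  have e: "(c - 1) div int n * int n + (c - 1) mod int n = c - 1" by simp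
  have m: "0 \<le> (c - 1) mod int n" "(c - 1) mod int n < int n" using assms by auto
  have "(c - 1) div int n * int n < c" using e m by linarith
  then have "real_of_int ((c - 1) div int n) * real n < real_of_int c"
    by (metis of_int_less_iff of_int_mult of_int_of_nat_eq)
  then show "real_of_int ((c - 1) div int n + 1) - 1 < real_of_int c / real n"
    using n by (simp add: field_simps)
  have "c \<le> ((c - 1) div int n + 1) * int n" using e m unfolding distrib_right by linarith
  then have "real_of_int c \<le> real_of_int ((c - 1) div int n + 1) * real n"
    by (metis of_int_le_iff of_int_mult of_int_of_nat_eq)
  then show "real_of_int c / real n \<le> real_of_int ((c - 1) div int n + 1)"
    using n by (simp add: field_simps)
qed

text \<open>Division with remainder, the remainders being 1 to n. It splits a coordinate into a
  block number, which enters \<rho>, and a residue, which enters the tabloids.\<close>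

lemma ceil_div_resid:
  assumes "n \<ge> 1" shows "c = (ceil_div n c - 1) * int n + resid n c"
  using assms by (simp add: ceil_div_eq resid_def)

lemma resid_tshift [simp]: "resid n (c + k * int n) = resid n c"
  by (simp add: resid_def) (metis add_diff_eq diff_add_eq mod_mult_self1)

lemma ceil_div_tshift: "n \<ge> 1 \<Longrightarrow> ceil_div n (c + k * int n) = ceil_div n c + k"
proof -
  assume n: "n \<ge> 1"
  have "(c + k * int n - 1) = (c - 1) + k * int n" by simp
  then show ?thesis using n by (simp only: ceil_div_eq) simp
qed

lemma resid_eqE:
  assumes "n \<ge> 1" "resid n i = resid n j" obtains k where "j = i + k * int n"
proof -
  have "j = i + (ceil_div n j - ceil_div n i) * int n"
    using ceil_div_resid[OF assms(1), of i] ceil_div_resid[OF assms(1), of j] assms(2)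
    by (simp add: algebra_simps)
  then show ?thesis by (rule that)
qed

text \<open>A translation adds the same number to the blocks of both coordinates, so the summand is
  constant on a class and the choice by \<open>SOME\<close> is immaterial.\<close>

lemma rho_entry_transversal:
  assumes n: "n \<ge> 1" and T: "transversal (tshift n) X T"
  shows "rho_entry n X = (\<Sum>x\<in>T. ceil_div n (snd x) - ceil_div n (fst x))"
proof -
  let ?c = "\<lambda>x. {y \<in> X. \<exists>k. y = tshift n k x}"
  let ?g = "\<lambda>c. ceil_div n (snd c) - ceil_div n (fst c)"
  have bij: "bij_betw ?c T (tclasses (tshift n) X)"
    by (rule transversal_bij_tclasses) (use T in auto)
  have "rho_entry n X = (\<Sum>x\<in>T. ?g (SOME c. c \<in> ?c x))"
    unfolding rho_entry_def Let_def by (rule sum.reindex_bij_betw[OF bij, symmetric])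
  also have "\<dots> = (\<Sum>x\<in>T. ?g x)"
  proof (rule sum.cong[OF refl])
    fix x assume "x \<in> T"
    then have "x \<in> ?c x" using T by (auto simp: transversal_def intro!: exI[of _ 0])
    then have "(SOME c. c \<in> ?c x) \<in> ?c x" by (rule someI)
    then obtain k where "(SOME c. c \<in> ?c x) = tshift n k x" by blast
    then show "?g (SOME c. c \<in> ?c x) = ?g x" using n by (simp add: ceil_div_tshift)
  qed
  finally show ?thesis .
qed

definition win :: "nat \<Rightarrow> ball set \<Rightarrow> ball set" where
  "win n X = {x \<in> X. 1 \<le> fst x \<and> fst x \<le> int n}"

lemma zero_shift_if_close:
  assumes "(a::int) = b + k * int n" "\<bar>a - b\<bar> < int n" shows "k = 0"
proof (rule ccontr)
  assume "k \<noteq> 0"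
  then have "int n \<le> \<bar>k\<bar> * int n" using mult_right_mono[of 1 "\<bar>k\<bar>" "int n"] by simp
  also have "\<dots> = \<bar>a - b\<bar>" using assms(1) by (simp add: abs_mult)
  finally show False using assms(2) by simp
qed

text \<open>Any n consecutive rows meet each class exactly once. The start \<open>r\<close> is free
  because \<open>chan_num_tshift\<close> counts from the row of a channel ball; elsewhere the window
  of rows 1 to n suffices.\<close>

lemma transversal_interval:
  assumes n: "n \<ge> 1" and X: "tinv n X"
  shows "transversal (tshift n) X {x \<in> X. r \<le> fst x \<and> fst x < r + int n}"
  unfolding transversal_def
proof (intro conjI ballI allI impI)
  fix x assume x: "x \<in> X"
  let ?q = "(fst x - r) div int n"
  have e: "?q * int n + (fst x - r) mod int n = fst x - r" by simp
  have m: "0 \<le> (fst x - r) mod int n" "(fst x - r) mod int n < int n" using n by auto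
  have "tshift n (- ?q) x \<in> X" using x X by (auto simp: tinv_def)
  moreover have "r \<le> fst x + - ?q * int n" "fst x + - ?q * int n < r + int n"
    using e m unfolding mult_minus_left by linarith+
  ultimately show "\<exists>k. tshift n k x \<in> {x \<in> X. r \<le> fst x \<and> fst x < r + int n}"
    by (intro exI[of _ "- ?q"]) simp
next
  fix x k assume "x \<in> {x \<in> X. r \<le> fst x \<and> fst x < r + int n}"
    "tshift n k x \<in> {x \<in> X. r \<le> fst x \<and> fst x < r + int n}"
  then have "k = 0" by (intro zero_shift_if_close[of "fst x + k * int n" "fst x" k n]) auto
  then show "tshift n k x = x" by simp
qed auto

lemma transversal_win:
  assumes "n \<ge> 1" "tinv n X" shows "transversal (tshift n) X (win n X)"
proof -
  have "win n X = {x \<in> X. 1 \<le> fst x \<and> fst x < 1 + int n}" by (auto simp: win_def)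
  then show ?thesis using transversal_interval[OF assms, of 1] by simp
qed

lemma ncls_win: "n \<ge> 1 \<Longrightarrow> tinv n X \<Longrightarrow> ncls n X = card (win n X)"
  by (rule ncls_transversal[OF transversal_win])

section \<open>Parity of inversions of finite permutation graphs\<close>

definition inversions :: "ball set \<Rightarrow> nat" where
  "inversions E = card {(p, q). p \<in> E \<and> q \<in> E \<and> sNE p q}"

definition crossed :: "ball \<Rightarrow> ball \<Rightarrow> bool" where
  "crossed p q \<longleftrightarrow> sNE p q \<or> sNE q p"

definition pgraph :: "ball set \<Rightarrow> bool" where
  "pgraph E \<longleftrightarrow> finite E \<and> inj_on fst E \<and> inj_on snd E"

lemma pgraph_subset: "pgraph E \<Longrightarrow> F \<subseteq> E \<Longrightarrow> pgraph F"
  by (auto simp: pgraph_def intro: finite_subset inj_on_subset)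

text \<open>A crossed pair with one ball in each part is an inversion in exactly one of its two
  orders; the map \<open>?f\<close> in the proof picks that order.\<close>

lemma inversions_Un:
  assumes "finite X" "finite Y" "X \<inter> Y = {}"
  shows "inversions (X \<union> Y) = inversions X + inversions Y + card {(p, q). p \<in> X \<and> q \<in> Y \<and> crossed p q}"
proof -
  let ?I = "\<lambda>E. {(p, q). p \<in> E \<and> q \<in> E \<and> sNE p q}"
  let ?C = "{(p, q). p \<in> X \<and> q \<in> Y \<and> crossed p q}"
  let ?f = "\<lambda>(p, q). if sNE p q then (p, q) else (q, p)"
  have fin: "finite (?I E)" if "finite E" for E
    by (rule finite_subset[of _ "E \<times> E"]) (use that in auto)
  have finC: "finite ?C" by (rule finite_subset[of _ "X \<times> Y"]) (use assms in auto)
  have inj: "inj_on ?f ?C"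
    using assms(3) by (auto simp: inj_on_def split: if_splits)
  have eq: "?I (X \<union> Y) = (?I X \<union> ?I Y) \<union> ?f ` ?C"
  proof (intro set_eqI iffI)
    fix z assume "z \<in> ?I (X \<union> Y)"
    then obtain p q where z: "z = (p, q)" "p \<in> X \<union> Y" "q \<in> X \<union> Y" "sNE p q" by blast
    have "\<not> sNE q p" using z(4) by (auto simp: sNE_def)
    then have "(p, q) \<in> ?f ` ?C" if "p \<in> Y" "q \<in> X"
      using that z(4) by (intro image_eqI[of _ _ "(q, p)"]) (auto simp: crossed_def)
    moreover have "(p, q) \<in> ?f ` ?C" if "p \<in> X" "q \<in> Y"
      using that z(4) by (intro image_eqI[of _ _ "(p, q)"]) (auto simp: crossed_def)
    ultimately show "z \<in> (?I X \<union> ?I Y) \<union> ?f ` ?C" using z by blast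
  qed (auto simp: crossed_def split: if_splits)
  have disj: "?I X \<inter> ?I Y = {}" "(?I X \<union> ?I Y) \<inter> ?f ` ?C = {}"
    using assms(3) by (auto split: if_splits)
  have "card (?I (X \<union> Y)) = card (?I X \<union> ?I Y) + card (?f ` ?C)"
    unfolding eq by (rule card_Un_disjoint) (use fin assms finC disj in auto)
  also have "card (?I X \<union> ?I Y) = card (?I X) + card (?I Y)"
    by (rule card_Un_disjoint) (use fin assms disj in auto)
  finally show ?thesis using card_image[OF inj] by (simp add: inversions_def)
qed

text \<open>With \<open>I\<close> the entries of the lower rows of a tabloid and \<open>J\<close>
  the row above them, this is what that row adds to \<open>tabloid_inv\<close>.\<close>

definition ltpairs :: "int set \<Rightarrow> int set \<Rightarrow> nat" where
  "ltpairs I J = card {(i, j). i \<in> I \<and> j \<in> J \<and> i < j}"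

lemma card_pairs_sum:
  assumes "finite X" "finite Y"
  shows "card {(p, q). p \<in> X \<and> q \<in> Y \<and> P p q} = (\<Sum>p\<in>X. \<Sum>q\<in>Y. of_bool (P p q))"
proof -
  have "{(p, q). p \<in> X \<and> q \<in> Y \<and> P p q} = (SIGMA p:X. {q \<in> Y. P p q})" by auto
  then show ?thesis using assms by (simp add: Int_def)
qed

lemma ltpairs_image:
  assumes "finite X" "finite Y" "inj_on f X" "inj_on f Y"
  shows "ltpairs (f ` X) (f ` Y) = (\<Sum>p\<in>X. \<Sum>q\<in>Y. of_bool (f p < f q))"
proof -
  have "ltpairs (f ` X) (f ` Y) = (\<Sum>i\<in>f ` X. \<Sum>j\<in>f ` Y. of_bool (i < j))"
    unfolding ltpairs_def by (rule card_pairs_sum) (use assms in auto)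
  then show ?thesis by (simp only: sum.reindex[OF assms(3)] sum.reindex[OF assms(4)] o_def)
qed

text \<open>Two balls in different rows and columns are crossed iff exactly one of the comparisons
  of their rows and of their columns is \<open><\<close>. So the three indicators have an even sum
  for every pair. This is where inv(P) and inv(Q) come from.\<close>

lemma inversions_Un_parity:
  assumes "pgraph (X \<union> Y)" "X \<inter> Y = {}"
  shows "even (inversions (X \<union> Y) + inversions X + inversions Y
    + ltpairs (fst ` X) (fst ` Y) + ltpairs (snd ` X) (snd ` Y))"
proof -
  have fin: "finite X" "finite Y" and inj: "inj_on fst (X \<union> Y)" "inj_on snd (X \<union> Y)"
    using assms(1) by (auto simp: pgraph_def)
  have inj': "inj_on fst X" "inj_on fst Y" "inj_on snd X" "inj_on snd Y"
    using inj by (auto simp: inj_on_Un)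
  have "card {(p, q). p \<in> X \<and> q \<in> Y \<and> crossed p q} + ltpairs (fst ` X) (fst ` Y) + ltpairs (snd ` X) (snd ` Y)
    = (\<Sum>p\<in>X. \<Sum>q\<in>Y. of_bool (crossed p q) + of_bool (fst p < fst q) + of_bool (snd p < snd q))"
    using fin inj' by (simp add: card_pairs_sum ltpairs_image sum.distrib)
  also have "even \<dots>"
  proof (intro dvd_sum)
    fix p q assume pq: "p \<in> X" "q \<in> Y"
    then have "p \<noteq> q" using assms(2) by auto
    then have "fst p \<noteq> fst q" "snd p \<noteq> snd q"
      using inj pq by (auto dest: inj_onD)
    then show "even (of_bool (crossed p q) + of_bool (fst p < fst q) + of_bool (snd p < snd q) :: nat)"
      by (auto simp: crossed_def sNE_def)
  qed
  finally show ?thesis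
    unfolding inversions_Un[OF fin assms(2)] even_add by sat
qed

text \<open>The mixed terms of \<open>inversions_Un_parity\<close> see only the sets of rows and
  columns. Exchanging one part for another with the same rows and columns therefore has the same
  effect on the parity of the whole as on that of the part.\<close>

lemma inversions_Un_cong:
  assumes "pgraph (X \<union> Y)" "X \<inter> Y = {}" "pgraph (X \<union> Z)" "X \<inter> Z = {}"
    "fst ` Y = fst ` Z" "snd ` Y = snd ` Z"
  shows "even (inversions (X \<union> Y) + inversions (X \<union> Z) + inversions Y + inversions Z)"
proof -
  have *: "even (a + x + y + u + v) \<Longrightarrow> even (b + x + z + u + v) \<Longrightarrow> even (a + b + y + z)"
    for a b x y z u v :: nat unfolding even_add by sat
  show ?thesis
    using inversions_Un_parity[OF assms(1,2)] inversions_Un_parity[OF assms(3,4)]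
    unfolding assms(5,6) by (rule *)
qed

lemma inversions_single [simp]: "inversions {p} = 0"
proof -
  have "{(a, b). a \<in> {p} \<and> b \<in> {p} \<and> sNE a b} = {}" by (auto simp: sNE_def)
  then show ?thesis unfolding inversions_def by (simp only: card.empty)
qed

lemma inversions_empty [simp]: "inversions {} = 0"
  by (simp add: inversions_def)

lemma inversions_swap:
  assumes "x \<noteq> x'" "y \<noteq> y'"
  shows "odd (inversions {(x, y), (x', y')} + inversions {(x, y'), (x', y)})"
proof -
  have 1: "{(x, y), (x', y')} = {(x, y)} \<union> {(x', y')}" "{(x, y'), (x', y)} = {(x, y')} \<union> {(x', y)}"
    by auto
  have 2: "inversions ({p} \<union> {q}) = of_bool (crossed p q)" if "p \<noteq> q" for p q
    using that inversions_Un[of "{p}" "{q}"] card_pairs_sum[of "{p}" "{q}" crossed] by simp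
  show ?thesis
    unfolding 1 using assms by (subst (1 2) 2) (auto simp: crossed_def sNE_def)
qed

lemma pgraph_zip:
  assumes "distinct xs" "distinct ys" shows "pgraph (set (zip xs ys))"
proof -
  have "distinct (map fst (zip xs ys))" "distinct (map snd (zip xs ys))"
    using assms by (simp_all add: map_fst_zip_take map_snd_zip_take)
  then show ?thesis by (simp add: pgraph_def distinct_map)
qed

lemma set_zip_rotate:
  assumes "length xs = length ys" "ys \<noteq> []"
  shows "fst ` set (zip xs (last ys # butlast ys)) = set xs"
    "snd ` set (zip xs (last ys # butlast ys)) = set ys"
proof -
  have l: "length xs = length (last ys # butlast ys)" using assms by (cases ys) auto
  have "fst ` set (zip xs (last ys # butlast ys)) = set (map fst (zip xs (last ys # butlast ys)))"
    "snd ` set (zip xs (last ys # butlast ys)) = set (map snd (zip xs (last ys # butlast ys)))"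
    by auto
  moreover have "set (last ys # butlast ys) = set ys"
    using append_butlast_last_id[OF assms(2)] by (metis list.set(2) rotate1.simps(2) set_rotate1 
        Un_insert_right append_Nil2 list.set(1) set_append sup_bot_right)
  ultimately show "fst ` set (zip xs (last ys # butlast ys)) = set xs"
    "snd ` set (zip xs (last ys # butlast ys)) = set ys"
    using l by (simp_all only: map_fst_zip map_snd_zip)
qed

lemma distinct_rotate_last:
  assumes "distinct ys" "ys \<noteq> []" shows "distinct (last ys # butlast ys)"
proof -
  have "distinct (butlast ys @ [last ys])"
    unfolding append_butlast_last_id[OF assms(2)] by (rule assms(1))
  then show ?thesis by simp
qed

text \<open>A cycle of length l is a product of l - 1 transpositions. The induction swaps the first
  two columns, which puts the second row in its final place, and then rotates the remaining rows.
  Nothing is assumed about the order of the entries.\<close>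

lemma inversions_rotate:
  assumes "length xs = length ys" "ys \<noteq> []" "distinct xs" "distinct ys"
  shows "even (inversions (set (zip xs ys)) + inversions (set (zip xs (last ys # butlast ys)))
     + (length xs - 1))"
  using assms
proof (induction "length xs" arbitrary: xs ys)
  case 0
  then show ?case by simp
next
  case (Suc l)
  show ?case
  proof (cases l)
    case 0
    then obtain x y where "xs = [x]" "ys = [y]"
      using Suc by (metis One_nat_def length_0_conv length_Suc_conv)
    then show ?thesis by simp
  next
    case (Suc l')
    then obtain x x2 xs' where xs: "xs = x # x2 # xs'"
      using Suc.hyps(2) by (metis length_Suc_conv)
    obtain y y2 ys' where ys: "ys = y # y2 # ys'"
      using Suc.hyps(2) Suc.prems(1) Suc by (metis length_Suc_conv)
    have len: "length xs' = length ys'" using Suc.prems xs ys by simp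
    \<comment> \<open>\<open>R\<close> is the tail untouched by the first swap. \<open>D\<close> is
      the rotation of the shorter lists left once (x2, y), already in its final position, is set
      aside.\<close>
    define R where "R = set (zip xs' ys')"
    define D where "D = set (zip (x # xs') (last (y2 # ys') # butlast (y2 # ys')))"
    have g1: "pgraph ({(x, y), (x2, y2)} \<union> R)" "pgraph ({(x, y2), (x2, y)} \<union> R)"
      using pgraph_zip[OF Suc.prems(3,4)] pgraph_zip[of xs "y2 # y # ys'"] Suc.prems
      by (auto simp: xs ys R_def)
    have d1: "R \<inter> {(x, y), (x2, y2)} = {}" "R \<inter> {(x, y2), (x2, y)} = {}"
      using Suc.prems by (auto simp: xs R_def dest: set_zip_leftD)
    have s1: "even (inversions ({(x, y), (x2, y2)} \<union> R) + inversions ({(x, y2), (x2, y)} \<union> R)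
      + inversions {(x, y), (x2, y2)} + inversions {(x, y2), (x2, y)})"
      using inversions_Un_cong[of R "{(x, y), (x2, y2)}" "{(x, y2), (x2, y)}"] g1 d1
      by (simp add: Un_commute insert_commute)
    have s2: "odd (inversions {(x, y), (x2, y2)} + inversions {(x, y2), (x2, y)})"
      by (rule inversions_swap) (use Suc.prems xs ys in auto)
    have ih: "even (inversions (set (zip (x # xs') (y2 # ys'))) + inversions D + (length (x # xs') - 1))"
      unfolding D_def by (rule Suc.hyps(1)) (use Suc.hyps Suc.prems xs ys in auto)
    have rot: "set (zip xs (last ys # butlast ys)) = {(x2, y)} \<union> D"
      by (auto simp: xs ys D_def)
    have img: "fst ` D = set (x # xs')" "snd ` D = set (y2 # ys')"
      unfolding D_def using set_zip_rotate[of "x # xs'" "y2 # ys'"] len by auto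
    have d2: "{(x2, y)} \<inter> D = {}"
    proof -
      have "(x2, y) \<notin> D"
      proof
        assume "(x2, y) \<in> D"
        then have "x2 \<in> fst ` D" by force
        then show False using img Suc.prems xs by auto
      qed
      then show ?thesis by simp
    qed
    have g2: "pgraph ({(x2, y)} \<union> D)"
      unfolding rot[symmetric] using Suc.prems by (intro pgraph_zip distinct_rotate_last)
    have e3: "{(x2, y)} \<union> set (zip (x # xs') (y2 # ys')) = {(x, y2), (x2, y)} \<union> R"
      by (auto simp: R_def)
    have s3: "even (inversions ({(x2, y)} \<union> set (zip (x # xs') (y2 # ys'))) + inversions ({(x2, y)} \<union> D)
       + inversions (set (zip (x # xs') (y2 # ys'))) + inversions D)"
    proof (rule inversions_Un_cong)
      show "pgraph ({(x2, y)} \<union> set (zip (x # xs') (y2 # ys')))" unfolding e3 by (rule g1)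
      show "{(x2, y)} \<inter> set (zip (x # xs') (y2 # ys')) = {}"
        using Suc.prems xs by (auto dest: set_zip_leftD)
      have "fst ` set (zip (x # xs') (y2 # ys')) = set (map fst (zip (x # xs') (y2 # ys')))" by auto
      then show "fst ` set (zip (x # xs') (y2 # ys')) = fst ` D"
        using img len by (simp only: map_fst_zip) simp
      have "snd ` set (zip (x # xs') (y2 # ys')) = set (map snd (zip (x # xs') (y2 # ys')))" by auto
      then show "snd ` set (zip (x # xs') (y2 # ys')) = snd ` D"
        using img len by (simp only: map_snd_zip) simp
    qed (use d2 g2 in auto)
    have e0: "set (zip xs ys) = {(x, y), (x2, y2)} \<union> R" by (auto simp: xs ys R_def)
    have "length xs - 1 = (length (x # xs') - 1) + 1" by (simp add: xs)
    then have "even (length xs - 1) \<longleftrightarrow> odd (length (x # xs') - 1)" by simp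
    then show ?thesis using s1 s2 s3 ih unfolding e3 rot e0 even_add by sat
  qed
qed


section \<open>Channels\<close>

locale pperm =
  fixes n :: nat and B :: "ball set"
  assumes n_pos: "n \<ge> 1" and tinv_B: "tinv n B"
    and inj_fst: "inj_on fst B" and inj_snd: "inj_on snd B"
begin

lemma n_int_pos: "int n > 0"
  using n_pos by simp

lemma fst_eqD: "a \<in> B \<Longrightarrow> b \<in> B \<Longrightarrow> fst a = fst b \<Longrightarrow> a = b"
  using inj_fst by (auto dest: inj_onD)

lemma snd_eqD: "a \<in> B \<Longrightarrow> b \<in> B \<Longrightarrow> snd a = snd b \<Longrightarrow> a = b"
  using inj_snd by (auto dest: inj_onD)

lemma tshift_in: "b \<in> B \<Longrightarrow> tshift n k b \<in> B"
  using tinv_B by (auto simp: tinv_def)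

lemma finite_win: "X \<subseteq> B \<Longrightarrow> finite (win n X)"
proof (rule inj_on_finite[of fst _ "{1..int n}"])
  assume "X \<subseteq> B"
  then show "inj_on fst (win n X)" by (intro inj_on_subset[OF inj_fst]) (auto simp: win_def)
qed (auto simp: win_def)

lemma chainset_ncls: "chainset n B C \<Longrightarrow> ncls n C = card (win n C)"
  using n_pos by (simp add: ncls_win chainset_def)

lemma chainset_finite_win: "chainset n B C \<Longrightarrow> finite (win n C)"
  by (rule finite_win) (simp add: chainset_def)

text \<open>Balls comparable in both orders share a row or a column, and in a partial permutation
  this makes them equal. Hence northwest chains are southwest antichains.\<close>

lemma chainset_wSW_eq:
  assumes "chainset n B C" "a \<in> C" "b \<in> C" "wSW a b" shows "a = b"
proof -
  have "a \<in> B" "b \<in> B" "wNW a b \<or> wNW b a" using assms by (auto simp: chainset_def)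
  then show ?thesis using assms(4) fst_eqD[of a b] snd_eqD[of a b] by (auto simp: wNW_def wSW_def)
qed

lemma wSW_antisym: "a \<in> B \<Longrightarrow> b \<in> B \<Longrightarrow> wSW a b \<Longrightarrow> wSW b a \<Longrightarrow> a = b"
  using fst_eqD[of a b] by (auto simp: wSW_def)

lemma tinv_win_subset:
  assumes "tinv n X" "tinv n Y" "win n X \<subseteq> Y" shows "X \<subseteq> Y"
proof
  fix x assume x: "x \<in> X"
  then obtain k where "tshift n k x \<in> win n X"
    using transversal_win[OF n_pos assms(1)] by (auto simp: transversal_def)
  then have "tshift n (-k) (tshift n k x) \<in> Y"
    using assms(2,3) unfolding tinv_def by blast
  then show "x \<in> Y" by simp
qed

lemma chainset_ncls_le: "chainset n B C \<Longrightarrow> ncls n C \<le> card (win n B)"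
  unfolding chainset_ncls by (rule card_mono[OF finite_win[OF subset_refl]])
    (auto simp: win_def chainset_def)

lemma ex_channel: "\<exists>C. is_channel n B C"
proof -
  have "chainset n B {}" by (simp add: chainset_def tinv_def)
  then obtain C where "chainset n B C" "\<forall>C'. chainset n B C' \<longrightarrow> ncls n C' \<le> ncls n C"
    using ex_has_greatest_nat[of "chainset n B" "{}" "ncls n" "Suc (card (win n B))"]
      chainset_ncls_le le_imp_less_Suc by blast
  then show ?thesis by (auto simp: is_channel_def)
qed

text \<open>By invariance a channel is determined by its part in the finite window.\<close>

lemma finite_channels: "finite {C. is_channel n B C}"
proof (rule inj_on_finite[of "win n" _ "Pow (win n B)"])
  show "inj_on (win n) {C. is_channel n B C}"
  proof (rule inj_onI)
    fix C C' assume a: "C \<in> {C. is_channel n B C}" "C' \<in> {C. is_channel n B C}" "win n C = win n C'"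
    then have t: "tinv n C" "tinv n C'" by (auto simp: is_channel_def chainset_def)
    have "win n C \<subseteq> C'" "win n C' \<subseteq> C" using a(3) by (auto simp: win_def)
    then show "C = C'" using tinv_win_subset t by blast
  qed
  show "win n ` {C. is_channel n B C} \<subseteq> Pow (win n B)"
    by (auto simp: is_channel_def chainset_def win_def)
qed (simp add: finite_win)

section \<open>The lattice of channels and the southwest-most channel\<close>

definition below :: "ball set \<Rightarrow> ball set \<Rightarrow> bool" where
  "below C C' \<longleftrightarrow> (\<forall>b\<in>C. \<exists>b'\<in>C'. wSW b b')"

lemma below_trans: "below C C' \<Longrightarrow> below C' C'' \<Longrightarrow> below C C''"
  unfolding below_def wSW_def by (meson order_trans)

text \<open>Two balls that are not northwest-comparable are southwest-comparable, and between two
  minimal (or two maximal) balls this forces equality. Invariance holds because translation respects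
  the southwest order.\<close>

lemma chainset_extremal:
  assumes "C1 \<subseteq> B" "C2 \<subseteq> B" "tinv n C1" "tinv n C2"
  shows "chainset n B {c \<in> C1 \<union> C2. \<forall>a\<in>C1 \<union> C2. wSW a c \<longrightarrow> a = c}"
    "chainset n B {c \<in> C1 \<union> C2. \<forall>a\<in>C1 \<union> C2. wSW c a \<longrightarrow> a = c}"
proof -
  have sh: "tshift n k a \<in> C1 \<union> C2" if "a \<in> C1 \<union> C2" for a k
    using that assms(3,4) by (auto simp: tinv_def)
  have cmp: "wNW a b \<or> wNW b a \<or> wSW a b \<or> wSW b a" for a b
    by (auto simp: wNW_def wSW_def)
  have refl: "wNW a a" for a by (simp add: wNW_def)
  have wsh: "wSW a (tshift n k c) \<Longrightarrow> wSW (tshift n (- k) a) c"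
    "wSW (tshift n k c) a \<Longrightarrow> wSW c (tshift n (- k) a)" for a c k
    by (auto simp: wSW_def)
  have eqsh: "tshift n (- k) a = c \<Longrightarrow> a = tshift n k c" for a c k
    by (auto simp: tshift_def)
  have "tinv n {c \<in> C1 \<union> C2. \<forall>a\<in>C1 \<union> C2. wSW a c \<longrightarrow> a = c}"
    "tinv n {c \<in> C1 \<union> C2. \<forall>a\<in>C1 \<union> C2. wSW c a \<longrightarrow> a = c}"
    unfolding tinv_def using sh wsh eqsh by blast+
  then show "chainset n B {c \<in> C1 \<union> C2. \<forall>a\<in>C1 \<union> C2. wSW a c \<longrightarrow> a = c}"
    "chainset n B {c \<in> C1 \<union> C2. \<forall>a\<in>C1 \<union> C2. wSW c a \<longrightarrow> a = c}"
    unfolding chainset_def using assms(1,2) cmp refl by blast+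
qed

text \<open>As in Dilworth's lattice of maximum antichains, the southwest-minimal and southwest-maximal
  balls of the union of two channels form chains whose sizes add up to at least the sizes of the
  two channels, so both are channels.\<close>

lemma channel_meet:
  assumes C1: "is_channel n B C1" and C2: "is_channel n B C2"
  shows "\<exists>C. is_channel n B C \<and> below C C1 \<and> below C C2"
proof -
  define U where "U = C1 \<union> C2"
  define lo where "lo = {c \<in> U. \<forall>a\<in>U. wSW a c \<longrightarrow> a = c}"
  define hi where "hi = {c \<in> U. \<forall>a\<in>U. wSW c a \<longrightarrow> a = c}"
  have ch: "chainset n B C1" "chainset n B C2" using assms by (auto simp: is_channel_def)
  have ti: "tinv n C1" "tinv n C2" and sub: "C1 \<subseteq> B" "C2 \<subseteq> B"
    using ch by (auto simp: chainset_def)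
  have lo: "chainset n B lo" and hi: "chainset n B hi"
    unfolding lo_def hi_def U_def using chainset_extremal sub ti by auto
  have le: "card (win n lo) \<le> card (win n C1)" "card (win n hi) \<le> card (win n C1)"
    and eq12: "card (win n C2) = card (win n C1)"
    using C1 C2 lo hi ch unfolding is_channel_def by (simp_all add: chainset_ncls) (metis chainset_ncls le_antisym)
  \<comment> \<open>A ball \<open>c\<close> outside both sets lies strictly between some
    \<open>a\<close> and \<open>b\<close> in the southwest order. Two of these three balls belong to
    the same channel, contradicting \<open>chainset_wSW_eq\<close>.\<close>
  have U: "lo \<union> hi = U"
  proof
    show "U \<subseteq> lo \<union> hi"
    proof
      fix c assume c: "c \<in> U"
      show "c \<in> lo \<union> hi"
      proof (rule ccontr)
        assume "c \<notin> lo \<union> hi"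
        then obtain a b where ab: "a \<in> U" "wSW a c" "a \<noteq> c" "b \<in> U" "wSW c b" "b \<noteq> c"
          using c by (auto simp: lo_def hi_def)
        have "wSW a b" using ab by (auto simp: wSW_def)
        then have "a \<noteq> b" using ab c wSW_antisym[of a c] sub by (auto simp: U_def)
        then show False
          using ab c \<open>wSW a b\<close> chainset_wSW_eq[OF ch(1)] chainset_wSW_eq[OF ch(2)]
          unfolding U_def by blast
      qed
    qed
  qed (auto simp: lo_def hi_def)
  \<comment> \<open>A ball of both channels is southwest-comparable to no other ball of either, so
    it is minimal and maximal at once.\<close>
  have I: "C1 \<inter> C2 \<subseteq> lo \<inter> hi"
    using chainset_wSW_eq[OF ch(1)] chainset_wSW_eq[OF ch(2)]
    unfolding lo_def hi_def U_def by blast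
  have fin: "finite (win n C1)" "finite (win n C2)" "finite (win n lo)" "finite (win n hi)"
    using ch lo hi by (auto intro: chainset_finite_win)
  have winU: "win n (X \<union> Y) = win n X \<union> win n Y" "win n (X \<inter> Y) = win n X \<inter> win n Y" for X Y
    by (auto simp: win_def)
  have "card (win n C1) + card (win n C2) = card (win n U) + card (win n (C1 \<inter> C2))"
    unfolding U_def winU by (rule card_Un_Int) (use fin in auto)
  moreover have "card (win n lo) + card (win n hi) = card (win n U) + card (win n (lo \<inter> hi))"
    unfolding U[symmetric] winU by (rule card_Un_Int) (use fin in auto)
  moreover have subI: "win n (C1 \<inter> C2) \<subseteq> win n (lo \<inter> hi)" using I by (auto simp: win_def)
  moreover have finI: "finite (win n (lo \<inter> hi))" using fin by (simp add: winU)
  ultimately have "card (win n lo) = card (win n C1)" and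
    cI: "card (win n (C1 \<inter> C2)) = card (win n (lo \<inter> hi))"
    using le eq12 card_mono[OF finI subI] by linarith+
  then have chan: "is_channel n B lo"
    using lo C1 ch(1) by (simp add: is_channel_def chainset_ncls)
  \<comment> \<open>Maximality of the channels turns all the inequalities between cardinalities into
    equalities, so the inclusion \<open>I\<close> is an equality as well.\<close>
  have "win n (C1 \<inter> C2) = win n (lo \<inter> hi)"
    by (rule card_subset_eq) (use finI subI cI in auto)
  then have "win n (lo \<inter> hi) \<subseteq> C1 \<inter> C2" by (auto simp: win_def)
  moreover have "tinv n (lo \<inter> hi)" "tinv n (C1 \<inter> C2)"
    using lo hi ti unfolding chainset_def tinv_def by blast+
  ultimately have I': "lo \<inter> hi \<subseteq> C1 \<inter> C2"
    using tinv_win_subset[of "lo \<inter> hi" "C1 \<inter> C2"] by blast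
  have "\<exists>a\<in>C1. wSW c a" "\<exists>a\<in>C2. wSW c a" if c: "c \<in> lo" for c
  proof -
    have r: "wSW c c" by (simp add: wSW_def)
    have cU: "c \<in> U" using c by (simp add: lo_def)
    have "(\<exists>a\<in>C1. wSW c a) \<and> (\<exists>a\<in>C2. wSW c a)"
    proof (cases "c \<in> C1 \<inter> C2")
      case True then show ?thesis using r by blast
    next
      case False
      \<comment> \<open>A minimal ball in only one channel is not maximal. A ball northeast of it
        cannot lie in the same channel, hence lies in the other one.\<close>
      then have "c \<notin> hi" using I' c by blast
      then obtain a where "a \<in> U" "wSW c a" "a \<noteq> c" using cU by (auto simp: hi_def)
      then show ?thesis
        using cU r chainset_wSW_eq[OF ch(1), of c a] chainset_wSW_eq[OF ch(2), of c a]
        unfolding U_def by blast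
    qed
    then show "\<exists>a\<in>C1. wSW c a" "\<exists>a\<in>C2. wSW c a" by auto
  qed
  then show ?thesis using chan unfolding below_def by blast
qed

text \<open>There are finitely many channels, so repeated use of \<open>channel_meet\<close> reaches
  one below all of them.\<close>

lemma ex_sw_channel: "\<exists>C. is_channel n B C \<and> (\<forall>C'. is_channel n B C' \<longrightarrow> below C C')"
proof -
  obtain C0 where C0: "is_channel n B C0" using ex_channel by blast
  have "\<exists>C. is_channel n B C \<and> (\<forall>C'\<in>K. below C C')"
    if "finite K" "K \<subseteq> {C. is_channel n B C}" for K
    using that
  proof (induction K rule: finite_induct)
    case empty
    then show ?case using C0 by auto
  next
    case (insert C1 K)
    then obtain C where "is_channel n B C" "\<forall>C'\<in>K. below C C'" by auto
    moreover obtain C2 where "is_channel n B C2" "below C2 C" "below C2 C1"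
      using channel_meet[of C C1] calculation insert.prems by auto
    ultimately show ?case using below_trans by blast
  qed
  from this[OF finite_channels] show ?thesis by auto
qed

text \<open>A ball c of \<open>C\<close> is southwest of some d in \<open>D\<close>, which is
  southwest of some c' in \<open>C\<close>. Within a chain c = c', so d is squeezed to c. The other
  inclusion is the same statement with \<open>C\<close> and \<open>D\<close> exchanged.\<close>

lemma sw_channel_unique:
  assumes "is_channel n B C" "\<forall>C'. is_channel n B C' \<longrightarrow> below C C'"
    "is_channel n B D" "\<forall>C'. is_channel n B C' \<longrightarrow> below D C'"
  shows "C \<subseteq> D"
proof
  fix c assume c: "c \<in> C"
  obtain d where d: "d \<in> D" "wSW c d" using assms c unfolding below_def by blast
  obtain c' where c': "c' \<in> C" "wSW d c'" using assms d unfolding below_def by blast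
  have "wSW c c'" using d c' by (auto simp: wSW_def)
  then have "c = c'" using chainset_wSW_eq[of C c c'] c c' assms(1) by (simp add: is_channel_def)
  moreover have "c \<in> B" "d \<in> B" using c d assms by (auto simp: is_channel_def chainset_def)
  ultimately have "c = d" using wSW_antisym d c' by blast
  then show "c \<in> D" using d by simp
qed

lemma sw_channelI:
  assumes "is_channel n B C" "\<forall>C'. is_channel n B C' \<longrightarrow> below C C'"
  shows "sw_channel n B = C"
  unfolding sw_channel_def below_def[symmetric]
  by (rule the_equality) (use assms sw_channel_unique in blast)+

lemma sw_channel: "is_channel n B (sw_channel n B)"
  and sw_channel_below: "is_channel n B C' \<Longrightarrow> below (sw_channel n B) C'"
  using ex_sw_channel sw_channelI by auto

lemma sw_chainset: "chainset n B (sw_channel n B)"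
  using sw_channel by (simp add: is_channel_def)

lemma sw_channel_max: "chainset n B C \<Longrightarrow> ncls n C \<le> ncls n (sw_channel n B)"
  using sw_channel by (simp add: is_channel_def)

section \<open>The same balls seen with a multiple of the period\<close>

lemma pperm_mult: "p \<ge> 1 \<Longrightarrow> pperm (p * n) B"
  using n_pos inj_fst inj_snd tshift_in
  by unfold_locales (auto simp: tinv_def tshift_mult)

lemma tinv_mult: "tinv n X \<Longrightarrow> tinv (p * n) X"
  by (auto simp: tinv_def tshift_mult)

text \<open>The window of length \<open>p * n\<close> is tiled by p translates of the window of
  length n.\<close>

lemma ncls_mult:
  assumes p: "p \<ge> 1" and X: "tinv n X" "X \<subseteq> B"
  shows "ncls (p * n) X = p * ncls n X"
proof -
  have "finite (win (p * n) X) \<and> card (win (p * n) X) = p * card (win n X)"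
  proof (induction p)
    case 0
    have "win (0 * n) X = {}" by (auto simp: win_def)
    then show ?case by simp
  next
    case (Suc p)
    have e: "win (Suc p * n) X = win (p * n) X \<union> tshift n (int p) ` win n X"
    proof (intro set_eqI iffI)
      fix x assume x: "x \<in> win (Suc p * n) X"
      show "x \<in> win (p * n) X \<union> tshift n (int p) ` win n X"
      proof (cases "fst x \<le> int (p * n)")
        case True then show ?thesis using x by (auto simp: win_def)
      next
        case False
        then have "tshift n (- int p) x \<in> win n X"
          using x X(1) by (auto simp: win_def tinv_def algebra_simps)
        then show ?thesis by (intro UnI2 image_eqI[of _ _ "tshift n (- int p) x"]) auto
      qed
    next
      fix x assume "x \<in> win (p * n) X \<union> tshift n (int p) ` win n X"
      then show "x \<in> win (Suc p * n) X"
        using X(1) add_increasing2[of "int n * int p" 1]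
        by (auto simp: win_def tinv_def algebra_simps)
    qed
    have d: "win (p * n) X \<inter> tshift n (int p) ` win n X = {}" by (auto simp: win_def)
    have "inj_on (tshift n (int p)) (win n X)" by (auto simp: inj_on_def)
    then show ?case unfolding e using Suc d finite_win[OF X(2)]
      by (simp add: card_Un_disjoint card_image)
  qed
  then show ?thesis using ncls_win[of "p * n" X] ncls_win[of n X] p n_pos X tinv_mult by simp
qed

text \<open>Translation by n is an automorphism of the whole situation at period
  \<open>p * n\<close>: it commutes with the longer translations and preserves the northwest
  order.\<close>

lemma is_channel_tshift:
  assumes p: "p \<ge> 1" and C: "is_channel (p * n) B C"
  shows "is_channel (p * n) B (tshift n k ` C)"
proof -
  interpret M: pperm "p * n" B by (rule pperm_mult[OF p])
  have ch: "chainset (p * n) B C" using C by (simp add: is_channel_def)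
  then have t: "tinv (p * n) C" by (simp add: chainset_def)
  have "tshift (p * n) j (tshift n k x) = tshift n k (tshift (p * n) j x)" for j x
    by (simp add: tshift_mult add.commute)
  note comm = this
  have inj: "inj (tshift n k)" by (simp add: inj_on_def)
  have "chainset (p * n) B (tshift n k ` C)"
    unfolding chainset_def
  proof (intro conjI)
    show "tshift n k ` C \<subseteq> B" using ch tshift_in by (auto simp: chainset_def)
    show "tinv (p * n) (tshift n k ` C)" using t by (auto simp: tinv_def comm)
    show "\<forall>a\<in>tshift n k ` C. \<forall>b\<in>tshift n k ` C. wNW a b \<or> wNW b a"
      using ch by (auto simp: chainset_def wNW_def)
  qed
  moreover have "ncls (p * n) (tshift n k ` C) = ncls (p * n) C"
  proof -
    have "transversal (tshift (p * n)) (tshift n k ` C) (tshift n k ` win (p * n) C)"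
      using transversal_win[OF M.n_pos t] unfolding transversal_def
      by (simp add: comm image_subset_iff ball_simps inj_image_mem_iff[OF inj] del: tshift_tshift)
        blast
    then show ?thesis
      using ncls_transversal ncls_win[OF M.n_pos t] card_image[of "tshift n k" "win (p * n) C"]
      by (metis inj_onI tshift_eq_iff)
  qed
  ultimately show ?thesis using C by (simp add: is_channel_def)
qed

text \<open>The southwest-most channel for the period \<^term>\<open>p * n\<close> is unique, hence invariant under the
  translations by \<^term>\<open>n\<close>. Chains of long period are therefore no denser than channels.\<close>

lemma sw_channel_mult_tinv:
  assumes p: "p \<ge> 1"
  shows "tinv n (sw_channel (p * n) B)"
proof -
  interpret M: pperm "p * n" B by (rule pperm_mult[OF p])
  let ?C = "sw_channel (p * n) B"
  have "sw_channel (p * n) B = tshift n k ` ?C" for k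
  proof (rule M.sw_channelI)
    show "is_channel (p * n) B (tshift n k ` ?C)"
      by (rule is_channel_tshift[OF p M.sw_channel])
    show "\<forall>C'. is_channel (p * n) B C' \<longrightarrow> M.below (tshift n k ` ?C) C'"
    proof (intro allI impI)
      fix C' assume "is_channel (p * n) B C'"
      then have "M.below ?C (tshift n (- k) ` C')"
        by (intro M.sw_channel_below is_channel_tshift[OF p])
      then show "M.below (tshift n k ` ?C) C'"
        unfolding M.below_def by (force simp: wSW_def)
    qed
  qed
  then show ?thesis unfolding tinv_def by blast
qed

text \<open>The channel of period \<open>p * n\<close> bounds \<open>X\<close>. Being invariant
  under n, it has p times as many classes at period \<open>p * n\<close> as at period n, where it is
  itself bounded by the channel of \<open>B\<close>.\<close>

lemma chainset_mult_ncls_le: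
  assumes p: "p \<ge> 1" and X: "chainset (p * n) B X"
  shows "ncls (p * n) X \<le> p * ncls n (sw_channel n B)"
proof -
  interpret M: pperm "p * n" B by (rule pperm_mult[OF p])
  let ?C = "sw_channel (p * n) B"
  have "ncls (p * n) X \<le> ncls (p * n) ?C" by (rule M.sw_channel_max[OF X])
  also have "\<dots> = p * ncls n ?C"
    by (rule ncls_mult[OF p sw_channel_mult_tinv[OF p]]) (use M.sw_chainset in \<open>simp add: chainset_def\<close>)
  also have "ncls n ?C \<le> ncls n (sw_channel n B)"
    using M.sw_chainset sw_channel_mult_tinv[OF p] by (intro sw_channel_max) (simp add: chainset_def)
  finally show ?thesis by simp
qed

end


section \<open>The channel numbering\<close>

lemma int_ex_greatest:
  assumes "P (x::int)" "\<And>y. P y \<Longrightarrow> y \<le> u"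
  shows "\<exists>z. P z \<and> (\<forall>y. P y \<longrightarrow> y \<le> z)"
proof -
  obtain z where z: "P z" "\<forall>y. P y \<longrightarrow> nat (u - z) \<le> nat (u - y)"
    using ex_has_least_nat[of P x "\<lambda>y. nat (u - y)"] assms(1) by blast
  have "y \<le> z" if "P y" for y
    using z(2)[rule_format, OF that] assms(2)[OF that] assms(2)[OF z(1)] by simp
  then show ?thesis using z(1) by blast
qed

text \<open>A set of integers unbounded on both sides has the order type of the integers. It is
  applied to the rows of the channel.\<close>

lemma ex_int_numbering:
  fixes R :: "int set"
  assumes up: "\<And>z. \<exists>r\<in>R. z \<le> r" and down: "\<And>z. \<exists>r\<in>R. r < z"
  shows "\<exists>f. bij_betw f R (UNIV :: int set) \<and> (\<forall>x\<in>R. \<forall>y\<in>R. x < y \<longrightarrow> f x < f y)"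
proof -
  \<comment> \<open>The signed number of elements of \<open>R\<close> between 0 and
    \<open>x\<close>. It grows by one exactly on passing an element of \<open>R\<close>.\<close>
  define cnt where "cnt x = int (card (R \<inter> {0..<x})) - int (card (R \<inter> {x..<0}))" for x
  have step: "cnt (x + 1) = cnt x + of_bool (x \<in> R)" for x
  proof (cases "0 \<le> x")
    case True
    then have "{0..<x + 1} = insert x {0..<x}" "{x..<0} = {}" "{x + 1..<0} = {}" by auto
    then show ?thesis by (simp add: cnt_def Int_insert_right)
  next
    case False
    then have "{x..<0} = insert x {x + 1..<0}" "{0..<x} = {}" "{0..<x + 1} = {}" by auto
    then show ?thesis by (simp add: cnt_def Int_insert_right)
  qed
  have mono: "cnt x \<le> cnt y" if "x \<le> y" for x y
    using that
  proof (induction y rule: int_ge_induct)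
    case (step i)
    then show ?case using \<open>\<And>x. cnt (x + 1) = cnt x + of_bool (x \<in> R)\<close>[of i] by auto
  qed simp
  have strict: "cnt x < cnt y" if "x \<in> R" "x < y" for x y
    using step[of x] mono[of "x + 1" y] that by simp
  have large: "\<exists>y. int k \<le> cnt y" for k
  proof (induction k)
    case 0
    show ?case by (rule exI[of _ 0]) (simp add: cnt_def)
  next
    case (Suc k)
    then obtain y where y: "int k \<le> cnt y" by blast
    obtain r where "r \<in> R" "y \<le> r" using up by blast
    then show ?case using y step[of r] mono[of y r] by (intro exI[of _ "r + 1"]) simp
  qed
  have small: "\<exists>y. cnt y \<le> - int k" for k
  proof (induction k)
    case 0
    show ?case by (rule exI[of _ 0]) (simp add: cnt_def)
  next
    case (Suc k)
    then obtain y where y: "cnt y \<le> - int k" by blast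
    obtain r where "r \<in> R" "r < y" using down by blast
    then show ?case using y strict[of r y] by (intro exI[of _ r]) simp
  qed
  have surj: "\<exists>x\<in>R. cnt x = v" for v
  proof -
    obtain y where "cnt y \<le> - int (nat \<bar>v\<bar>)" using small by blast
    then have y: "cnt y \<le> v" by simp
    obtain y' where "int (nat \<bar>v\<bar> + 1) \<le> cnt y'" using large by blast
    then have y': "v < cnt y'" by simp
    have "y < y'" using y y' mono[of y' y] by (cases "y < y'") auto
    then have ex: "v < cnt (y + int (nat (y' - y)))" using y' by simp
    \<comment> \<open>A discrete intermediate value argument: the last step before the count exceeds
      \<open>v\<close> passes an element of \<open>R\<close>, and there the count equals
      \<open>v\<close>.\<close>
    define k where "k = (LEAST k. v < cnt (y + int k))"
    have k: "v < cnt (y + int k)" unfolding k_def by (rule LeastI[of _ "nat (y' - y)"]) (rule ex)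
    then have "k \<noteq> 0" using y by (intro notI) simp
    then obtain j where j: "k = Suc j" by (cases k) auto
    have "\<not> v < cnt (y + int j)" using not_less_Least[of j "\<lambda>k. v < cnt (y + int k)"] j k_def by simp
    moreover have "cnt (y + int k) = cnt (y + int j) + of_bool (y + int j \<in> R)"
      using step[of "y + int j"] j by (simp add: algebra_simps)
    ultimately show ?thesis using k by (cases "y + int j \<in> R") (auto intro!: bexI[of _ "y + int j"])
  qed
  have "inj_on cnt R"
  proof (rule inj_onI)
    fix x y assume "x \<in> R" "y \<in> R" "cnt x = cnt y"
    then show "x = y" using strict[of x y] strict[of y x] by (cases x y rule: linorder_cases) auto
  qed
  moreover have "v \<in> cnt ` R" for v using surj[of v] by blast
  then have "cnt ` R = UNIV" by blast
  ultimately show ?thesis using strict by (intro exI[of _ cnt]) (auto simp: bij_betw_def)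
qed

section \<open>Paths into the channel and finiteness of d\<close>

context pperm
begin

text \<open>Also the period of d along a class (\<open>dval_tshift\<close>), the number of levels up
  to translation, and the size of the row recorded at this step (\<open>ncls_backS\<close>).\<close>

definition channel_size :: nat where "channel_size = ncls n (sw_channel n B)"

text \<open>The predicate under \<open>GREATEST\<close> in \<open>dval_def\<close>.\<close>

definition is_val :: "ball \<Rightarrow> int \<Rightarrow> bool" where
  "is_val b v \<longleftrightarrow> (\<exists>bs. bs \<noteq> [] \<and> hd bs = b \<and> set bs \<subseteq> B \<and>
      last bs \<in> sw_channel n B \<and>
      (\<forall>i. i + 1 < length bs \<longrightarrow> sNW (bs ! (i + 1)) (bs ! i)) \<and>
      v = chan_num n B (last bs) + int (length bs - 1))"

lemma sw_sub: "c \<in> sw_channel n B \<Longrightarrow> c \<in> B"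
  using sw_chainset by (auto simp: chainset_def)

lemma sw_tshift: "c \<in> sw_channel n B \<Longrightarrow> tshift n k c \<in> sw_channel n B"
  using sw_chainset by (auto simp: chainset_def tinv_def)

lemma sw_less:
  assumes "a \<in> sw_channel n B" "b \<in> sw_channel n B" "fst a < fst b" shows "snd a < snd b"
  using assms sw_chainset snd_eqD[OF sw_sub sw_sub, of a b]
  by (fastforce simp: chainset_def wNW_def)

lemma ex_tshift_NW: "\<exists>k. sNW (tshift n k c) b" "\<exists>k. sNW b (tshift n k c)"
proof -
  \<comment> \<open>Larger than every coordinate difference that occurs. Since n is at least 1,
    translating by \<open>k\<close> moves at least this far, and the same \<open>k\<close> serves
    both directions.\<close>
  define k where "k = \<bar>fst b\<bar> + \<bar>fst c\<bar> + \<bar>snd b\<bar> + \<bar>snd c\<bar> + 1"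
  have "k * 1 \<le> k * int n" using n_int_pos by (intro mult_left_mono) (auto simp: k_def)
  moreover have "fst c - k < fst b" "snd c - k < snd b" "fst b < fst c + k" "snd b < snd c + k"
    by (auto simp: k_def)
  ultimately have "sNW (tshift n (- k) c) b" "sNW b (tshift n k c)"
    unfolding sNW_def fst_tshift snd_tshift mult_minus_left by linarith+
  then show "\<exists>k. sNW (tshift n k c) b" "\<exists>k. sNW b (tshift n k c)" by blast+
qed

context
  assumes nonempty: "B \<noteq> {}"
begin

text \<open>The class of a single ball is a chain, because translation moves it southeast.\<close>

lemma channel_size_pos: "channel_size \<ge> 1"
proof -
  obtain b where b: "b \<in> B" using nonempty by blast
  let ?O = "range (\<lambda>k. tshift n k b)"
  have t: "tinv n ?O" by (auto simp: tinv_def)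
  have "wNW (tshift n k b) (tshift n l b)" if "k \<le> l" for k l
    using mult_right_mono[OF that, of "int n"] by (simp add: wNW_def)
  then have ch: "chainset n B ?O"
    unfolding chainset_def
  proof (intro conjI ballI)
    fix x y assume "x \<in> ?O" "y \<in> ?O"
    then obtain k l where "x = tshift n k b" "y = tshift n l b" by blast
    then show "wNW x y \<or> wNW y x"
      using \<open>\<And>k l. k \<le> l \<Longrightarrow> wNW (tshift n k b) (tshift n l b)\<close>[of k l]
        \<open>\<And>k l. k \<le> l \<Longrightarrow> wNW (tshift n k b) (tshift n l b)\<close>[of l k] by (cases "k \<le> l") auto
  qed (use t tshift_in[OF b] in blast)+
  have "win n ?O \<noteq> {}"
    using transversal_win[OF n_pos t] by (auto simp: transversal_def)
  then have "card (win n ?O) > 0" using chainset_finite_win[OF ch] by (simp add: card_gt_0_iff)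
  then show ?thesis using sw_channel_max[OF ch] chainset_ncls[OF ch] by (simp add: channel_size_def)
qed

lemma sw_nonempty: "sw_channel n B \<noteq> {}"
proof
  assume "sw_channel n B = {}"
  then have "channel_size = 0" by (simp add: channel_size_def ncls_def tclasses_def)
  then show False using channel_size_pos by simp
qed

text \<open>The property demanded by \<open>SOME\<close> in \<open>chan_num_def\<close> can be met:
  the channel is nonempty and invariant, so its rows are unbounded on both sides, and a numbering of
  the rows is one of the balls.\<close>

lemma chan_num_props:
  "bij_betw (chan_num n B) (sw_channel n B) (UNIV :: int set) \<and>
      (\<forall>a\<in>sw_channel n B. \<forall>b\<in>sw_channel n B. a \<noteq> b \<and> wNW a b \<longrightarrow> chan_num n B a < chan_num n B b)"
proof -
  let ?C = "sw_channel n B"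
  obtain c where c: "c \<in> ?C" using sw_nonempty by blast
  have up: "\<exists>r\<in>fst ` ?C. z \<le> r" for z
    using ex_tshift_NW(2)[of "(z, z)" c] sw_tshift[OF c] unfolding sNW_def
    by (metis fst_conv imageI less_imp_le)
  have down: "\<exists>r\<in>fst ` ?C. r < z" for z
    using ex_tshift_NW(1)[of c "(z, z)"] sw_tshift[OF c] unfolding sNW_def
    by (metis fst_conv imageI)
  obtain f where f: "bij_betw f (fst ` ?C) (UNIV :: int set)"
    "\<forall>x\<in>fst ` ?C. \<forall>y\<in>fst ` ?C. x < y \<longrightarrow> f x < f y"
    using ex_int_numbering[of "fst ` ?C"] up down by blast
  have "bij_betw fst ?C (fst ` ?C)"
    by (rule inj_on_imp_bij_betw) (use inj_on_subset[OF inj_fst] sw_sub in blast)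
  then have "bij_betw (f \<circ> fst) ?C UNIV" using f(1) by (rule bij_betw_trans)
  moreover have "(f \<circ> fst) a < (f \<circ> fst) b" if "a \<in> ?C" "b \<in> ?C" "a \<noteq> b \<and> wNW a b" for a b
  proof -
    have "fst a \<noteq> fst b" using that fst_eqD[OF sw_sub sw_sub] by blast
    then have "fst a < fst b" using that by (simp add: wNW_def)
    then show ?thesis using f(2) that by simp
  qed
  ultimately have "\<exists>f. bij_betw f ?C (UNIV :: int set) \<and>
      (\<forall>a\<in>?C. \<forall>b\<in>?C. a \<noteq> b \<and> wNW a b \<longrightarrow> f a < f b)" by blast
  from someI_ex[OF this] show ?thesis unfolding chan_num_def .
qed

lemma chan_num_less_iff:
  assumes "a \<in> sw_channel n B" "b \<in> sw_channel n B"
  shows "chan_num n B a < chan_num n B b \<longleftrightarrow> fst a < fst b"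
proof -
  have l: "chan_num n B a < chan_num n B b"
    if "a \<in> sw_channel n B" "b \<in> sw_channel n B" "fst a < fst b" for a b
  proof -
    have "a \<noteq> b \<and> wNW a b" using that sw_less[OF that] by (auto simp: wNW_def)
    then show ?thesis using chan_num_props that by blast
  qed
  show ?thesis
    using l[OF assms] l[OF assms(2,1)] fst_eqD[OF sw_sub sw_sub, OF assms]
    by (cases "fst a" "fst b" rule: linorder_cases) auto
qed

text \<open>The numbers from that of \<open>a\<close> up to that of its next translate belong to the
  channel balls in n consecutive rows starting at \<open>a\<close>, and these form a
  transversal.\<close>

lemma chan_num_tshift:
  assumes "a \<in> sw_channel n B"
  shows "chan_num n B (tshift n k a) = chan_num n B a + k * int channel_size"
proof -
  let ?C = "sw_channel n B" and ?f = "chan_num n B"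
  have step: "?f (tshift n 1 a) = ?f a + int channel_size" if a: "a \<in> ?C" for a
  proof -
    let ?S = "{c \<in> ?C. fst a \<le> fst c \<and> fst c < fst a + int n}"
    have a1: "tshift n 1 a \<in> ?C" using a by (rule sw_tshift)
    have "?f ` ?S = {?f a..<?f (tshift n 1 a)}"
    proof (intro set_eqI iffI)
      fix v assume "v \<in> ?f ` ?S"
      then obtain c where "c \<in> ?C" "fst a \<le> fst c" "fst c < fst a + int n" "v = ?f c" by blast
      then show "v \<in> {?f a..<?f (tshift n 1 a)}"
        using chan_num_less_iff[of c a] chan_num_less_iff[of c "tshift n 1 a"] a a1 by auto
    next
      fix v assume v: "v \<in> {?f a..<?f (tshift n 1 a)}"
      obtain c where c: "c \<in> ?C" "v = ?f c"
        using chan_num_props unfolding bij_betw_def by (metis UNIV_I imageE)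
      then have "c \<in> ?S"
        using v chan_num_less_iff[of c a] chan_num_less_iff[of c "tshift n 1 a"] a a1 by auto
      then show "v \<in> ?f ` ?S" using c by blast
    qed
    moreover have "inj_on ?f ?S"
      using chan_num_props by (auto simp: bij_betw_def intro: inj_on_subset)
    ultimately have "card ?S = card {?f a..<?f (tshift n 1 a)}"
      using card_image[of ?f ?S] by simp
    moreover have "channel_size = card ?S"
      unfolding channel_size_def using n_pos sw_chainset
      by (intro ncls_transversal transversal_interval) (auto simp: chainset_def)
    moreover have "?f a < ?f (tshift n 1 a)"
      using chan_num_less_iff[OF a a1] n_int_pos by simp
    ultimately show ?thesis by simp
  qed
  show ?thesis
  proof (induction k rule: int_induct[where k = 0])
    case (step1 i)
    then show ?case using step[OF sw_tshift[OF assms, of i]]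
      by (simp add: algebra_simps)
  next
    case (step2 i)
    then show ?case using step[OF sw_tshift[OF assms, of "i - 1"]]
      by (simp add: algebra_simps)
  qed simp
qed

lemma is_val_channel: "c \<in> sw_channel n B \<Longrightarrow> is_val c (chan_num n B c)"
  unfolding is_val_def by (rule exI[of _ "[c]"]) (auto simp: sw_sub)

lemma is_val_step:
  assumes "is_val a v" "b \<in> B" "sNW a b" shows "is_val b (v + 1)"
proof -
  obtain bs where bs: "bs \<noteq> []" "hd bs = a" "set bs \<subseteq> B" "last bs \<in> sw_channel n B"
    "\<forall>i. i + 1 < length bs \<longrightarrow> sNW (bs ! (i + 1)) (bs ! i)"
    "v = chan_num n B (last bs) + int (length bs - 1)"
    using assms(1) unfolding is_val_def by blast
  have "sNW ((b # bs) ! (i + 1)) ((b # bs) ! i)" if "i + 1 < length (b # bs)" for i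
    using that bs(1,2,5) assms(3) by (cases i) (auto simp: hd_conv_nth)
  moreover have "v + 1 = chan_num n B (last (b # bs)) + int (length (b # bs) - 1)"
    using bs(1,6) by (cases bs) auto
  ultimately show ?thesis
    unfolding is_val_def using bs assms(2) by (intro exI[of _ "b # bs"]) auto
qed

lemma is_val_cases:
  assumes "is_val b v"
  obtains "b \<in> sw_channel n B" "v = chan_num n B b"
  | a where "a \<in> B" "sNW a b" "is_val a (v - 1)"
proof -
  obtain bs where bs: "bs \<noteq> []" "hd bs = b" "set bs \<subseteq> B" "last bs \<in> sw_channel n B"
    "\<forall>i. i + 1 < length bs \<longrightarrow> sNW (bs ! (i + 1)) (bs ! i)"
    "v = chan_num n B (last bs) + int (length bs - 1)"
    using assms(1) unfolding is_val_def by blast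
  then obtain cs where cs: "bs = b # cs" by (cases bs) auto
  show ?thesis
  proof (cases "cs = []")
    case True
    then show ?thesis using bs cs that(1) by simp
  next
    case False
    have "sNW (hd cs) b" using bs(5)[rule_format, of 0] False cs by (simp add: hd_conv_nth)
    moreover have "sNW (cs ! (i + 1)) (cs ! i)" if "i + 1 < length cs" for i
      using bs(5)[rule_format, of "i + 1"] that cs by simp
    moreover have "v - 1 = chan_num n B (last cs) + int (length cs - 1)"
      using bs(6) cs False by (cases cs) auto
    moreover have "hd cs \<in> B" using False bs(3) cs by auto
    moreover have "set cs \<subseteq> B" "last cs \<in> sw_channel n B" using bs(3,4) cs False by auto
    ultimately have "is_val (hd cs) (v - 1)"
      unfolding is_val_def using False by (intro exI[of _ cs]) blast
    then show ?thesis using that(2) \<open>hd cs \<in> B\<close> \<open>sNW (hd cs) b\<close> by blast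
  qed
qed

lemma is_val_tshift:
  assumes "is_val b v" shows "is_val (tshift n k b) (v + k * int channel_size)"
proof -
  obtain bs where bs: "bs \<noteq> []" "hd bs = b" "set bs \<subseteq> B" "last bs \<in> sw_channel n B"
    "\<forall>i. i + 1 < length bs \<longrightarrow> sNW (bs ! (i + 1)) (bs ! i)"
    "v = chan_num n B (last bs) + int (length bs - 1)"
    using assms(1) unfolding is_val_def by blast
  then show ?thesis
    unfolding is_val_def
    by (intro exI[of _ "map (tshift n k) bs"])
      (auto simp: hd_map last_map sw_tshift tshift_in chan_num_tshift sNW_def)
qed

lemma ex_is_val:
  assumes "b \<in> B" shows "\<exists>v. is_val b v"
proof -
  obtain c where c: "c \<in> sw_channel n B" using sw_nonempty by blast
  obtain k where "sNW (tshift n k c) b" using ex_tshift_NW by blast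
  then show ?thesis using is_val_step[OF is_val_channel[OF sw_tshift[OF c]] assms] by blast
qed

text \<open>Repeating a path with a period \<^term>\<open>p * n\<close> that is long enough for its translates to lie in one
  chain bounds its length by \<^term>\<open>p * channel_size\<close>.\<close>

lemma path_length_le:
  assumes bs: "bs \<noteq> []" "set bs \<subseteq> B"
    and path: "\<forall>i. i + 1 < length bs \<longrightarrow> sNW (bs ! (i + 1)) (bs ! i)"
    and p: "p \<ge> 1" "sNW (hd bs) (tshift n (int p) (last bs))"
  shows "length bs \<le> p * channel_size"
proof -
  interpret M: pperm "p * n" B by (rule pperm_mult[OF p(1)])
  have "transp (\<lambda>a b. sNW b a)" by (auto simp: transp_def sNW_def)
  then have srt: "sorted_wrt (\<lambda>a b. sNW b a) bs"
    using path by (simp add: sorted_wrt_iff_nth_Suc_transp)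
  have cmp: "x = y \<or> sNW x y \<or> sNW y x" if xy: "x \<in> set bs" "y \<in> set bs" for x y
  proof -
    obtain i j where "i < length bs" "j < length bs" "x = bs ! i" "y = bs ! j"
      using xy by (metis in_set_conv_nth)
    then show ?thesis using sorted_wrt_nth_less[OF srt, of i j] sorted_wrt_nth_less[OF srt, of j i]
      by (metis linorder_neqE_nat)
  qed
  have hd: "wNW x (hd bs)" if x: "x \<in> set bs" for x
  proof -
    obtain i where i: "i < length bs" "x = bs ! i" using x by (metis in_set_conv_nth)
    then show ?thesis using sorted_wrt_nth_less[OF srt, of 0 i] bs(1)
      by (cases "i = 0") (auto simp: hd_conv_nth wNW_def sNW_def)
  qed
  have lst: "wNW (last bs) x" if x: "x \<in> set bs" for x
  proof -
    obtain i where i: "i < length bs" "x = bs ! i" using x by (metis in_set_conv_nth)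
    then have "i = length bs - 1 \<or> i < length bs - 1" by linarith
    then show ?thesis using i sorted_wrt_nth_less[OF srt, of i "length bs - 1"] bs(1)
      by (auto simp: last_conv_nth wNW_def sNW_def)
  qed
  let ?N = "p * n"
  \<comment> \<open>Paths run northwest, so \<open>hd bs\<close> is the southeast end and
    \<open>last bs\<close> the northwest end. By the choice of \<open>p\<close> the whole path
    precedes its next translate.\<close>
  have wrap: "sNW x (tshift ?N 1 y)" if "x \<in> set bs" "y \<in> set bs" for x y
    using hd[OF that(1)] lst[OF that(2)] p(2) by (auto simp: wNW_def sNW_def)
  have wrapk: "sNW (tshift ?N k x) (tshift ?N l y)" if "x \<in> set bs" "y \<in> set bs" "k < l" for x y k l
  proof -
    have "(k + 1) * int ?N \<le> l * int ?N" using that(3) by (intro mult_right_mono) auto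
    then show ?thesis using wrap[OF that(1,2)] by (simp add: sNW_def algebra_simps)
  qed
  define X where "X = {tshift ?N k x | k x. x \<in> set bs}"
  have "chainset ?N B X"
    unfolding chainset_def
  proof (intro conjI ballI)
    show "X \<subseteq> B" using bs(2) M.tshift_in by (auto simp: X_def)
    show "tinv ?N X" unfolding X_def tinv_def using tshift_tshift by blast
    fix a b assume "a \<in> X" "b \<in> X"
    then obtain k x l y where "a = tshift ?N k x" "b = tshift ?N l y" "x \<in> set bs" "y \<in> set bs"
      unfolding X_def by blast
    then show "wNW a b \<or> wNW b a"
      using wrapk[of x y k l] wrapk[of y x l k] cmp[of x y]
      by (cases k l rule: linorder_cases) (auto simp: wNW_def sNW_def)
  qed
  \<comment> \<open>Different translates of the path are strictly separated by \<open>wrapk\<close>,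
    so the path meets each class of \<open>X\<close> once and its length is the number of
    classes.\<close>
  moreover have "transversal (tshift ?N) X (set bs)"
    unfolding transversal_def
  proof (intro conjI ballI allI impI)
    show "set bs \<subseteq> X" unfolding X_def using tshift_0 by (metis (mono_tags, lifting) mem_Collect_eq subsetI)
    fix a assume "a \<in> X"
    then obtain k x where "a = tshift ?N k x" "x \<in> set bs" unfolding X_def by blast
    then show "\<exists>k. tshift ?N k a \<in> set bs" by (intro exI[of _ "- k"]) simp
  next
    fix x k assume x: "x \<in> set bs" "tshift ?N k x \<in> set bs"
    show "tshift ?N k x = x"
      using wrapk[OF x(2,1), of 0 k] wrapk[OF x(1,2), of k 0]
      by (cases k "0::int" rule: linorder_cases) (auto simp: sNW_def)
  qed
  moreover have "card (set bs) = length bs"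
  proof (rule distinct_card)
    show "distinct bs"
      unfolding distinct_conv_nth
    proof (intro allI impI)
      fix i j assume "i < length bs" "j < length bs" "i \<noteq> j"
      then show "bs ! i \<noteq> bs ! j"
        using sorted_wrt_nth_less[OF srt, of i j] sorted_wrt_nth_less[OF srt, of j i]
        by (cases i j rule: linorder_cases) (auto simp: sNW_def)
    qed
  qed
  ultimately show ?thesis
    using chainset_mult_ncls_le[OF p(1), of X] ncls_transversal[of ?N X "set bs"]
    by (simp add: channel_size_def)
qed

text \<open>A longer path reaches further northwest, to a channel ball with a smaller number. With a
  fixed channel ball \<open>c0\<close> southeast of \<open>b\<close>, the length of the path exceeds
  the difference of the numbers of \<open>c0\<close> and of its end by at most
  \<open>channel_size\<close>, so the two effects cancel up to a constant.\<close>

lemma is_val_bounded: "\<exists>u. \<forall>v. is_val b v \<longrightarrow> v \<le> u"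
proof -
  obtain c where c: "c \<in> sw_channel n B" using sw_nonempty by blast
  obtain k where k: "sNW b (tshift n k c)" using ex_tshift_NW by blast
  define c0 where "c0 = tshift n k c"
  have c0: "c0 \<in> sw_channel n B" "sNW b c0" using k sw_tshift[OF c] by (auto simp: c0_def)
  let ?f = "chan_num n B"
  have "v \<le> ?f c0 + int channel_size - 1" if v: "is_val b v" for v
  proof -
    obtain bs where bs: "bs \<noteq> []" "hd bs = b" "set bs \<subseteq> B" "last bs \<in> sw_channel n B"
      "\<forall>i. i + 1 < length bs \<longrightarrow> sNW (bs ! (i + 1)) (bs ! i)"
      "v = ?f (last bs) + int (length bs - 1)"
      using v unfolding is_val_def by blast
    let ?e = "last bs"
    have "transp (\<lambda>a b. sNW b a)" by (auto simp: transp_def sNW_def)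
    then have srt: "sorted_wrt (\<lambda>a b. sNW b a) bs"
      using bs(5) by (simp add: sorted_wrt_iff_nth_Suc_transp)
    have "fst ?e \<le> fst b"
      using sorted_wrt_nth_less[OF srt, of 0 "length bs - 1"] bs(1,2)
      by (cases "length bs = 1") (auto simp: last_conv_nth hd_conv_nth sNW_def)
    then have less: "?f ?e < ?f c0"
      using chan_num_less_iff[OF bs(4) c0(1)] c0(2) by (simp add: sNW_def)
    \<comment> \<open>The least number of periods that carries the end of the path beyond
      \<open>c0\<close> on the channel. Then \<open>path_length_le\<close> applies, and
      \<open>q * channel_size\<close> overshoots the difference of the numbers by at most one
      \<open>channel_size\<close>.\<close>
    define q where "q = (?f c0 - ?f ?e) div int channel_size + 1"
    have m: "int channel_size > 0" using channel_size_pos by simp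
    have q: "q \<ge> 1" using less m by (simp add: q_def pos_imp_zdiv_nonneg_iff)
    have qm: "q * int channel_size = (?f c0 - ?f ?e) - (?f c0 - ?f ?e) mod int channel_size + int channel_size"
      by (simp add: q_def distrib_right minus_mod_eq_div_mult)
    have md: "0 \<le> (?f c0 - ?f ?e) mod int channel_size" "(?f c0 - ?f ?e) mod int channel_size < int channel_size"
      using m by auto
    have "?f c0 < ?f (tshift n q ?e)"
      unfolding chan_num_tshift[OF bs(4)] qm using md by linarith
    then have "fst c0 < fst (tshift n q ?e)" "snd c0 < snd (tshift n q ?e)"
      using chan_num_less_iff[OF c0(1) sw_tshift[OF bs(4)]] sw_less[OF c0(1) sw_tshift[OF bs(4)]]
      by blast+
    then have "sNW (hd bs) (tshift n (int (nat q)) ?e)"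
      using c0(2) bs(2) q by (simp add: sNW_def)
    then have "length bs \<le> nat q * channel_size"
      using path_length_le[OF bs(1,3,5), of "nat q"] q by simp
    then have "int (length bs) \<le> q * int channel_size"
      using q by (metis int_nat_eq of_nat_le_iff of_nat_mult order_trans zero_le_one)
    then show ?thesis using bs(1,6) md qm by (cases bs) auto
  qed
  then show ?thesis by blast
qed

lemma dval_greatest:
  assumes "b \<in> B"
  shows "is_val b (dval n B b)" "\<And>v. is_val b v \<Longrightarrow> v \<le> dval n B b"
proof -
  have e: "dval n B b = (GREATEST v. is_val b v)"
    unfolding dval_def is_val_def ..
  obtain z where z: "is_val b z" "\<forall>v. is_val b v \<longrightarrow> v \<le> z"
    using int_ex_greatest[of "is_val b"] ex_is_val[OF assms] is_val_bounded[of b] by blast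
  then have "dval n B b = z" unfolding e by (intro Greatest_equality) auto
  then show "is_val b (dval n B b)" "\<And>v. is_val b v \<Longrightarrow> v \<le> dval n B b" using z by auto
qed

lemma dval_mono:
  assumes "a \<in> B" "b \<in> B" "sNW a b" shows "dval n B a < dval n B b"
  using dval_greatest(2)[OF assms(2) is_val_step[OF dval_greatest(1)[OF assms(1)] assms(2,3)]] by simp

lemma dval_tshift:
  assumes "b \<in> B" shows "dval n B (tshift n k b) = dval n B b + k * int channel_size"
proof (rule antisym)
  have "is_val (tshift n (- k) (tshift n k b)) (dval n B (tshift n k b) + - k * int channel_size)"
    by (rule is_val_tshift[OF dval_greatest(1)[OF tshift_in[OF assms]]])
  then show "dval n B (tshift n k b) \<le> dval n B b + k * int channel_size"
    using dval_greatest(2)[OF assms, of "dval n B (tshift n k b) + - k * int channel_size"] by simp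
  show "dval n B b + k * int channel_size \<le> dval n B (tshift n k b)"
    by (rule dval_greatest(2)[OF tshift_in[OF assms] is_val_tshift[OF dval_greatest(1)[OF assms]]])
qed

text \<open>If an optimal path has a first step, that step leads to a suitable ball. Otherwise
  \<open>b\<close> is a channel ball valued by its own number, and its predecessor on the channel is
  suitable.\<close>

lemma dval_pred:
  assumes "b \<in> B" shows "\<exists>a\<in>B. sNW a b \<and> dval n B a = dval n B b - 1"
proof -
  have close: ?thesis if a: "a \<in> B" "sNW a b" "is_val a (dval n B b - 1)" for a
    using a dval_mono[OF a(1) assms a(2)] dval_greatest(2)[OF a(1,3)] by (intro bexI[of _ a]) auto
  show ?thesis
  proof (rule is_val_cases[OF dval_greatest(1)[OF assms]])
    assume b: "b \<in> sw_channel n B" "dval n B b = chan_num n B b"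
    obtain a where a: "a \<in> sw_channel n B" "chan_num n B a = chan_num n B b - 1"
      using chan_num_props unfolding bij_betw_def by (metis UNIV_I imageE)
    then have "fst a < fst b" using chan_num_less_iff[OF a(1) b(1)] by simp
    then have "sNW a b" using sw_less[OF a(1) b(1)] by (simp add: sNW_def)
    then show ?thesis using close[of a] a b(2) sw_sub is_val_channel[OF a(1)] by simp
  qed (use close in blast)
qed

end

end


section \<open>Rotating a level\<close>

lemma pgraph_Un:
  assumes "pgraph X" "pgraph Y" "fst ` X \<inter> fst ` Y = {}" "snd ` X \<inter> snd ` Y = {}"
  shows "pgraph (X \<union> Y)"
proof -
  have "fst ` (X - Y) \<inter> fst ` (Y - X) = {}" "snd ` (X - Y) \<inter> snd ` (Y - X) = {}"
    using assms(3,4) by blast+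
  then show ?thesis using assms(1,2) by (simp add: pgraph_def inj_on_Un)
qed

text \<open>The sets are exchanged one index at a time. The rest enters only through its rows and
  columns, which agree for both families, so each exchange contributes its own
  \<open>k t\<close>.\<close>

lemma inversions_UN:
  assumes "finite I"
    and "\<And>t. t \<in> I \<Longrightarrow> pgraph (X t)" "\<And>t. t \<in> I \<Longrightarrow> pgraph (Y t)"
    and "\<And>t. t \<in> I \<Longrightarrow> fst ` Y t = fst ` X t" "\<And>t. t \<in> I \<Longrightarrow> snd ` Y t = snd ` X t"
    and "\<And>s t. s \<in> I \<Longrightarrow> t \<in> I \<Longrightarrow> s \<noteq> t \<Longrightarrow> fst ` X s \<inter> fst ` X t = {}"
    and "\<And>s t. s \<in> I \<Longrightarrow> t \<in> I \<Longrightarrow> s \<noteq> t \<Longrightarrow> snd ` X s \<inter> snd ` X t = {}"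
    and "\<And>t. t \<in> I \<Longrightarrow> even (inversions (X t) + inversions (Y t) + k t)"
  shows "even (inversions (\<Union>t\<in>I. X t) + inversions (\<Union>t\<in>I. Y t) + (\<Sum>t\<in>I. k t))
    \<and> pgraph (\<Union>t\<in>I. X t) \<and> pgraph (\<Union>t\<in>I. Y t)"
  using assms
proof (induction I rule: finite_induct)
  case empty
  then show ?case by (simp add: pgraph_def)
next
  case (insert t I)
  define F G where "F = (\<Union>t\<in>I. X t)" and "G = (\<Union>t\<in>I. Y t)"
  have "even (inversions F + inversions G + (\<Sum>t\<in>I. k t)) \<and> pgraph F \<and> pgraph G"
    unfolding F_def G_def by (rule insert.IH) (simp_all add: insert.prems del: even_add)
  then have IH: "even (inversions F + inversions G + (\<Sum>t\<in>I. k t))" "pgraph F" "pgraph G"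
    by simp_all
  have fF: "fst ` F = (\<Union>s\<in>I. fst ` X s)" "snd ` F = (\<Union>s\<in>I. snd ` X s)"
    unfolding F_def by (simp_all add: image_UN)
  have GF: "fst ` G = fst ` F" "snd ` G = snd ` F"
    using insert.prems(3,4) by (simp_all add: image_UN F_def G_def)
  have dj: "fst ` X t \<inter> fst ` F = {}" "snd ` X t \<inter> snd ` F = {}"
    unfolding fF using insert.prems(5,6) insert.hyps by blast+
  have YX: "fst ` Y t = fst ` X t" "snd ` Y t = snd ` X t" using insert.prems(3,4) by auto
  have g: "pgraph (X t)" "pgraph (Y t)" using insert.prems by auto
  have nil: "A \<inter> C = {}" if "fst ` A \<inter> fst ` C = {}" for A C :: "ball set" using that by blast
  have g2: "pgraph (X t \<union> F)" "pgraph (Y t \<union> F)" "pgraph (Y t \<union> G)"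
    by (rule pgraph_Un; simp add: g IH(2,3) dj YX GF)+
  have n: "F \<inter> X t = {}" "F \<inter> Y t = {}" "Y t \<inter> F = {}" "Y t \<inter> G = {}"
    by (rule nil; use dj YX GF in \<open>simp add: Int_commute\<close>)+
  have g3: "pgraph (F \<union> X t)" "pgraph (F \<union> Y t)" using g2 by (simp_all add: Un_commute)
  \<comment> \<open>First \<open>X t\<close> becomes \<open>Y t\<close> beside the old rest
    \<open>F\<close>; then \<open>F\<close> becomes \<open>G\<close> beside
    \<open>Y t\<close>.\<close>
  have "even (inversions (F \<union> X t) + inversions (F \<union> Y t) + inversions (X t) + inversions (Y t))"
    by (rule inversions_Un_cong) (use g3 n YX in simp_all)
  then have 1: "even (inversions (X t \<union> F) + inversions (Y t \<union> F) + inversions (X t) + inversions (Y t))"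
    by (simp only: Un_commute)
  have 2: "even (inversions (Y t \<union> F) + inversions (Y t \<union> G) + inversions F + inversions G)"
    by (rule inversions_Un_cong) (use g2 n GF in simp_all)
  have 3: "even (inversions (X t) + inversions (Y t) + k t)" using insert.prems by simp
  have *: "even (a + b + x + y) \<Longrightarrow> even (b + c + f + g) \<Longrightarrow> even (x + y + k) \<Longrightarrow> even (f + g + l)
    \<Longrightarrow> even (a + c + (k + l))" for a b c x y f g k l :: nat
    unfolding even_add by sat
  have "even (inversions (X t \<union> F) + inversions (Y t \<union> G) + (k t + (\<Sum>t\<in>I. k t)))"
    by (rule *[OF 1 2 3 IH(1)])
  then show ?case using g2 insert.hyps by (simp add: F_def G_def)
qed

section \<open>Levels as lists sorted by rows\<close>

definition row_sorted :: "ball list \<Rightarrow> bool" where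
  "row_sorted bs \<longleftrightarrow> sorted_wrt (\<lambda>a b. fst a < fst b) bs"

lemma ex_row_sorted:
  assumes "finite D" "inj_on fst D"
  obtains bs where "set bs = D" "row_sorted bs"
proof -
  let ?h = "inv_into D fst" and ?l = "sorted_list_of_set (fst ` D)"
  have f: "finite (fst ` D)" using assms(1) by simp
  have 1: "set (map ?h ?l) = D"
    using f assms(2) by (simp add: image_image)
  have "fst (?h x) = x" if "x \<in> set ?l" for x
    using that f by (auto simp: f_inv_into_f)
  then have "map fst (map ?h ?l) = ?l" by (simp add: map_idI)
  then have "sorted_wrt (<) (map fst (map ?h ?l))" using strict_sorted_list_of_set[of "fst ` D"] by simp
  then have "row_sorted (map ?h ?l)" unfolding row_sorted_def sorted_wrt_map[of "(<)" fst] .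
  then show ?thesis using that 1 by blast
qed

lemma row_sorted_nth: "row_sorted bs \<Longrightarrow> i < j \<Longrightarrow> j < length bs \<Longrightarrow> fst (bs ! i) < fst (bs ! j)"
  unfolding row_sorted_def by (rule sorted_wrt_nth_less)

lemma row_sorted_nth_iff:
  assumes "row_sorted bs" "i < length bs" "j < length bs"
  shows "fst (bs ! i) < fst (bs ! j) \<longleftrightarrow> i < j"
  using row_sorted_nth[OF assms(1), of i j] row_sorted_nth[OF assms(1), of j i] assms(2,3)
  by (cases i j rule: linorder_cases) auto

lemma outer_corners_list:
  assumes "row_sorted bs"
  shows "outer_corners (set bs) = set (zip (tl (map fst bs)) (butlast (map snd bs)))"
proof -
  have "zip (tl (map fst bs)) (butlast (map snd bs))
      = map (\<lambda>i. (fst (bs ! (i + 1)), snd (bs ! i))) [0..<length bs - 1]"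
    by (rule nth_equalityI) (auto simp: nth_tl nth_butlast)
  then have z: "set (zip (tl (map fst bs)) (butlast (map snd bs)))
      = {(fst (bs ! (i + 1)), snd (bs ! i)) | i. i + 1 < length bs}"
    by auto
  show ?thesis
    unfolding z
  proof (intro set_eqI iffI)
    fix x assume "x \<in> outer_corners (set bs)"
    then obtain a a' where x: "x = (fst a', snd a)" "a \<in> set bs" "a' \<in> set bs" "fst a < fst a'"
      "\<not> (\<exists>c\<in>set bs. fst a < fst c \<and> fst c < fst a')"
      unfolding outer_corners_def by blast
    obtain i j where ij: "i < length bs" "a = bs ! i" "j < length bs" "a' = bs ! j"
      using x(2,3) by (metis in_set_conv_nth)
    have "i < j" using row_sorted_nth_iff[OF assms ij(1,3)] x(4) ij by simp
    have "j = i + 1"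
    proof (rule ccontr)
      assume "j \<noteq> i + 1"
      then have l: "i + 1 < j" using \<open>i < j\<close> by simp
      then have "fst a < fst (bs ! (i + 1))" "fst (bs ! (i + 1)) < fst a'"
        using row_sorted_nth[OF assms, of i "i + 1"] row_sorted_nth[OF assms, of "i + 1" j] ij by auto
      moreover have "bs ! (i + 1) \<in> set bs" using l ij by auto
      ultimately show False using x(5) by blast
    qed
    then show "x \<in> {(fst (bs ! (i + 1)), snd (bs ! i)) | i. i + 1 < length bs}" using x ij by blast
  next
    fix x assume "x \<in> {(fst (bs ! (i + 1)), snd (bs ! i)) | i. i + 1 < length bs}"
    then obtain i where i: "x = (fst (bs ! (i + 1)), snd (bs ! i))" "i + 1 < length bs" by blast
    have "\<not> (\<exists>c\<in>set bs. fst (bs ! i) < fst c \<and> fst c < fst (bs ! (i + 1)))"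
    proof
      assume "\<exists>c\<in>set bs. fst (bs ! i) < fst c \<and> fst c < fst (bs ! (i + 1))"
      then obtain k where "k < length bs" "fst (bs ! i) < fst (bs ! k)" "fst (bs ! k) < fst (bs ! (i + 1))"
        by (metis in_set_conv_nth)
      then have "i < k" "k < i + 1" using row_sorted_nth_iff[OF assms] i(2) by auto
      then show False by simp
    qed
    moreover have "fst (bs ! i) < fst (bs ! (i + 1))" using row_sorted_nth[OF assms] i(2) by simp
    ultimately show "x \<in> outer_corners (set bs)"
      using i unfolding outer_corners_def by (intro CollectI exI[of _ "bs ! i"] exI[of _ "bs ! (i + 1)"]) auto
  qed
qed

lemma back_corner_list:
  assumes s: "row_sorted bs" and "bs \<noteq> []"
  shows "back_corner (set bs) = (fst (hd bs), snd (last bs))"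
proof -
  let ?l = "length bs - 1"
  have l: "?l < length bs" "0 < length bs" using assms(2) by auto
  have ge: "fst (bs ! 0) \<le> fst b \<and> fst b \<le> fst (bs ! ?l)" if b: "b \<in> set bs" for b
  proof -
    obtain i where i: "i < length bs" "b = bs ! i" using b by (metis in_set_conv_nth)
    have "\<not> i < 0" "\<not> ?l < i" using i by auto
    then have "\<not> fst b < fst (bs ! 0)" "\<not> fst (bs ! ?l) < fst b"
      using row_sorted_nth_iff[OF s i(1) l(2)] row_sorted_nth_iff[OF s l(1) i(1)] i(2) by auto
    then show ?thesis by simp
  qed
  have "Min (fst ` set bs) = fst (bs ! 0)"
    by (rule Min_eqI) (use ge l in auto)
  moreover have M: "Max (fst ` set bs) = fst (bs ! ?l)"
    by (rule Max_eqI) (use ge l in auto)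
  moreover have "(THE b. b \<in> set bs \<and> fst b = fst (bs ! ?l)) = bs ! ?l"
  proof (rule the_equality)
    show "bs ! ?l \<in> set bs \<and> fst (bs ! ?l) = fst (bs ! ?l)" using l by simp
    fix b assume b: "b \<in> set bs \<and> fst b = fst (bs ! ?l)"
    then obtain i where i: "i < length bs" "b = bs ! i" by (metis in_set_conv_nth)
    then have "i = ?l" using row_sorted_nth_iff[OF s i(1) l(1)] b i by auto
    then show "b = bs ! ?l" using i by simp
  qed
  ultimately show ?thesis
    using assms(2) by (simp add: back_corner_def hd_conv_nth last_conv_nth)
qed

definition rotate_level :: "ball set \<Rightarrow> ball set" where
  "rotate_level D = insert (back_corner D) (outer_corners D)"

text \<open>The back corner pairs the first row with the last column and is the head of the rotated
  list; the outer corners pair each later row with the preceding column and are its tail.\<close>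

lemma rotate_level_list:
  assumes "row_sorted bs" "bs \<noteq> []"
  shows "rotate_level (set bs) = set (zip (map fst bs) (last (map snd bs) # butlast (map snd bs)))"
proof -
  have "zip (map fst bs) (last (map snd bs) # butlast (map snd bs))
     = (fst (hd bs), snd (last bs)) # zip (tl (map fst bs)) (butlast (map snd bs))"
    using assms(2) by (cases bs) (auto simp: last_map)
  then show ?thesis
    unfolding rotate_level_def back_corner_list[OF assms] outer_corners_list[OF assms(1)] by simp
qed

lemma row_sorted_map_tshift: "row_sorted bs \<Longrightarrow> row_sorted (map (tshift n k) bs)"
  by (auto simp: row_sorted_def sorted_wrt_map)

lemma set_zip_map_tshift:
  "set (zip (map (\<lambda>x. x + k * int n) xs) (map (\<lambda>x. x + k * int n) ys)) = tshift n k ` set (zip xs ys)"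
  by (simp add: zip_map_map tshift_def case_prod_unfold)

lemma corners_tshift:
  assumes "finite D" "inj_on fst D"
  shows "outer_corners (tshift n k ` D) = tshift n k ` outer_corners D"
    and "D \<noteq> {} \<Longrightarrow> back_corner (tshift n k ` D) = tshift n k (back_corner D)"
proof -
  obtain bs where bs: "set bs = D" "row_sorted bs" using ex_row_sorted[OF assms] .
  have s: "set (map (tshift n k) bs) = tshift n k ` D" using bs by simp
  note r = row_sorted_map_tshift[OF bs(2), of n k]
  have "map fst (map (tshift n k) bs) = map (\<lambda>x. x + k * int n) (map fst bs)"
    "map snd (map (tshift n k) bs) = map (\<lambda>x. x + k * int n) (map snd bs)" by simp_all
  then show "outer_corners (tshift n k ` D) = tshift n k ` outer_corners D"
    using outer_corners_list[OF r] outer_corners_list[OF bs(2)]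
    by (simp only: s bs(1) map_tl[symmetric] map_butlast[symmetric] set_zip_map_tshift)
  assume "D \<noteq> {}"
  then have "bs \<noteq> []" using bs by auto
  then show "back_corner (tshift n k ` D) = tshift n k (back_corner D)"
    using back_corner_list[OF r] back_corner_list[OF bs(2)] bs(1) s
    by (simp add: hd_map last_map tshift_def)
qed

text \<open>All claims are read off the list form. The back corner is not an outer corner because it
  alone occupies the first row of the level.\<close>

lemma rotate_level_props:
  assumes "finite D" "D \<noteq> {}" "inj_on fst D" "inj_on snd D"
  shows "pgraph (rotate_level D)" "fst ` rotate_level D = fst ` D" "snd ` rotate_level D = snd ` D"
    "back_corner D \<notin> outer_corners D" "fst (back_corner D) \<in> fst ` D" "snd (back_corner D) \<in> snd ` D"
    "outer_corners D \<subseteq> rotate_level D"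
proof -
  obtain bs where bs: "set bs = D" "row_sorted bs" using ex_row_sorted[OF assms(1,3)] .
  have ne: "bs \<noteq> []" using bs assms(2) by auto
  let ?xs = "map fst bs" and ?ys = "map snd bs"
  have e: "rotate_level D = set (zip ?xs (last ?ys # butlast ?ys))"
    using rotate_level_list[OF bs(2) ne] bs(1) by simp
  have dbs: "distinct bs" 
    unfolding distinct_conv_nth using row_sorted_nth[OF bs(2)] by (metis less_irrefl linorder_neqE_nat)
  have d: "distinct ?xs" "distinct ?ys" using dbs assms(3,4) bs(1) by (simp_all add: distinct_map)
  show "pgraph (rotate_level D)" unfolding e using d ne by (intro pgraph_zip distinct_rotate_last) auto
  show "fst ` rotate_level D = fst ` D" "snd ` rotate_level D = snd ` D"
    unfolding e using set_zip_rotate[of ?xs ?ys] ne bs(1) by auto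
  show "outer_corners D \<subseteq> rotate_level D" by (auto simp: rotate_level_def)
  have b: "back_corner D = (fst (hd bs), snd (last bs))" using back_corner_list[OF bs(2) ne] bs(1) by simp
  show "fst (back_corner D) \<in> fst ` D" "snd (back_corner D) \<in> snd ` D" using b bs ne by auto
  show "back_corner D \<notin> outer_corners D"
  proof
    assume "back_corner D \<in> outer_corners D"
    then have "(fst (hd bs), snd (last bs)) \<in> set (zip (tl ?xs) (butlast ?ys))"
      using b outer_corners_list[OF bs(2)] bs(1) by simp
    then have "fst (hd bs) \<in> set (tl ?xs)" by (rule set_zip_leftD)
    then show False using d(1) ne by (cases bs) auto
  qed
qed

text \<open>Reduction modulo n destroys the order of the rows and columns of a level but keeps them
  distinct. This is enough, since \<open>inversions_rotate\<close> concerns arbitrary distinct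
  entries.\<close>

lemma rotate_level_inversions:
  assumes "finite D" "D \<noteq> {}" "inj_on (\<lambda>b. f (fst b)) D" "inj_on (\<lambda>b. g (snd b)) D"
  shows "even (inversions (map_prod f g ` D) + inversions (map_prod f g ` rotate_level D) + (card D - 1))"
proof -
  have inj: "inj_on fst D" "inj_on snd D" using assms(3,4) by (auto simp: inj_on_def)
  obtain bs where bs: "set bs = D" "row_sorted bs" using ex_row_sorted[OF assms(1) inj(1)] .
  have ne: "bs \<noteq> []" using bs assms(2) by auto
  let ?xs = "map (\<lambda>b. f (fst b)) bs" and ?ys = "map (\<lambda>b. g (snd b)) bs"
  have dbs: "distinct bs"
    unfolding distinct_conv_nth using row_sorted_nth[OF bs(2)] by (metis less_irrefl linorder_neqE_nat)
  then have c: "card D = length bs" using bs(1) distinct_card by blast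
  have d: "distinct ?xs" "distinct ?ys" using dbs assms(3,4) bs(1) by (simp_all add: distinct_map)
  have "zip ?xs ?ys = map (map_prod f g) bs"
    by (rule nth_equalityI) (auto simp: map_prod_def case_prod_unfold)
  then have 1: "set (zip ?xs ?ys) = map_prod f g ` D" using bs(1) by simp
  have "zip ?xs (last ?ys # butlast ?ys)
     = map (map_prod f g) (zip (map fst bs) (last (map snd bs) # butlast (map snd bs)))"
  proof -
    have "?xs = map f (map fst bs)" "last ?ys # butlast ?ys = map g (last (map snd bs) # butlast (map snd bs))"
      using ne by (simp_all add: last_map map_butlast comp_def)
    then show ?thesis by (simp only: zip_map_map map_prod_def)
  qed
  then have 2: "set (zip ?xs (last ?ys # butlast ?ys)) = map_prod f g ` rotate_level D"
    using rotate_level_list[OF bs(2) ne] bs(1) by (simp only: set_map)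
  show ?thesis
    using inversions_rotate[of ?xs ?ys] d ne c unfolding 1 2 by simp
qed

section \<open>Affine inversions compared with inversions of residues\<close>

definition res :: "nat \<Rightarrow> ball \<Rightarrow> ball" where
  "res n = map_prod (resid n) (resid n)"

lemma fst_res [simp]: "fst (res n b) = resid n (fst b)"
  and snd_res [simp]: "snd (res n b) = resid n (snd b)"
  by (simp_all add: res_def)

lemma res_tshift [simp]: "res n (tshift n k b) = res n b"
  by (simp add: prod_eq_iff)

lemma res_transversal:
  assumes "transversal (tshift n) X T" shows "res n ` X = res n ` T"
proof
  show "res n ` X \<subseteq> res n ` T"
  proof
    fix y assume "y \<in> res n ` X"
    then obtain x where x: "x \<in> X" "y = res n x" by blast
    then obtain k where "tshift n k x \<in> T" using assms unfolding transversal_def by blast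
    then show "y \<in> res n ` T" using x by (metis imageI res_tshift)
  qed
qed (use assms in \<open>auto simp: transversal_def\<close>)

text \<open>The numbers of \<^term>\<open>k\<close> counted for \<^term>\<open>(a, b)\<close> and \<^term>\<open>(b, a)\<close> are the positive and the
  negative part of one integer.\<close>

lemma card_crossings_parity:
  assumes n: "n \<ge> 1" and a: "1 \<le> fst a" "fst a \<le> int n" and b: "1 \<le> fst b" "fst b \<le> int n"
    and ab: "fst a < fst b" "resid n (snd a) \<noteq> resid n (snd b)"
  shows "even (int (card {k. sNE a (tshift n k b)}) + int (card {k. sNE b (tshift n k a)})
    + (ceil_div n (snd a) - ceil_div n (fst a)) + (ceil_div n (snd b) - ceil_div n (fst b))
    + of_bool (crossed (res n a) (res n b)))"
proof -
  \<comment> \<open>The threshold of the columns: the translate of \<open>b\<close> by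
    \<open>k\<close> lies west of \<open>a\<close> iff \<open>k < q\<close>. The last summand
    accounts for the comparison of residues inside one block.\<close>
  define q where "q = ceil_div n (snd a) - ceil_div n (snd b) + of_bool (resid n (snd b) < resid n (snd a))"
  have N: "int n > 0" using n by simp
  have ra: "snd a = (ceil_div n (snd a) - 1) * int n + resid n (snd a)" by (rule ceil_div_resid[OF n])
  have rb: "snd b = (ceil_div n (snd b) - 1) * int n + resid n (snd b)" by (rule ceil_div_resid[OF n])
  have bd: "1 \<le> resid n (snd a)" "resid n (snd a) \<le> int n" "1 \<le> resid n (snd b)" "resid n (snd b) \<le> int n"
    using resid_bounds[OF n] by auto
  have fa: "ceil_div n (fst a) = 1" "ceil_div n (fst b) = 1"
    using a b n by (simp_all add: ceil_div_eq div_pos_pos_trivial)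
  have rfa: "resid n (fst a) = fst a" "resid n (fst b) = fst b"
    using a b n by (simp_all add: resid_def mod_pos_pos_trivial)
  have lt: "x * int n + c < y * int n + d \<longleftrightarrow> x < y \<or> x = y \<and> c < d"
    if "\<bar>c - d\<bar> < int n" for x y c d
  proof (cases x y rule: linorder_cases)
    case less
    then have "(x + 1) * int n \<le> y * int n" using N by (intro mult_right_mono) auto
    then show ?thesis using less that by (auto simp: distrib_right)
  next
    case greater
    then have "(y + 1) * int n \<le> x * int n" using N by (intro mult_right_mono) auto
    then show ?thesis using greater that by (auto simp: distrib_right)
  qed auto
  have s: "snd b + k * int n = (ceil_div n (snd b) - 1 + k) * int n + resid n (snd b)"
    "snd a + k * int n = (ceil_div n (snd a) - 1 + k) * int n + resid n (snd a)" for k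
    using ra rb by (simp_all add: algebra_simps)
  have rr: "\<bar>resid n (snd b) - resid n (snd a)\<bar> < int n" "\<bar>resid n (snd a) - resid n (snd b)\<bar> < int n"
    "\<bar>fst a - fst b\<bar> < int n" "\<bar>fst b - fst a\<bar> < int n"
    using bd a b by auto
  have 1: "snd b + k * int n < snd a \<longleftrightarrow> k < q" for k
    using lt[OF rr(1), of "ceil_div n (snd b) - 1 + k" "ceil_div n (snd a) - 1"]
    unfolding s(1)[symmetric] ra[symmetric] q_def by auto
  have 2: "snd a + k * int n < snd b \<longleftrightarrow> k < 1 - q" for k
    using lt[OF rr(2), of "ceil_div n (snd a) - 1 + k" "ceil_div n (snd b) - 1"] ab(2)
    unfolding s(2)[symmetric] rb[symmetric] q_def by auto
  have 3: "fst a < fst b + k * int n \<longleftrightarrow> 0 \<le> k" for k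
    using lt[OF rr(3), of 0 k] ab(1) by (auto simp: add.commute)
  have 4: "fst b < fst a + k * int n \<longleftrightarrow> 1 \<le> k" for k
    using lt[OF rr(4), of 0 k] ab(1) by (auto simp: add.commute)
  \<comment> \<open>In the window \<open>a\<close> is above \<open>b\<close>, so the row conditions
    are \<open>0 \<le> k\<close> one way and \<open>1 \<le> k\<close> the other. At most one of the
    two sets is nonempty, and their sizes add up to the absolute value of \<open>q\<close>.\<close>
  have "{k. sNE a (tshift n k b)} = {0..<q}" "{k. sNE b (tshift n k a)} = {1..<1 - q}"
    by (auto simp: sNE_def 1 2 3 4)
  then have "int (card {k. sNE a (tshift n k b)}) + int (card {k. sNE b (tshift n k a)}) = \<bar>q\<bar>"
    by simp
  moreover have "crossed (res n a) (res n b) \<longleftrightarrow> resid n (snd b) < resid n (snd a)"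
    using ab by (auto simp: crossed_def sNE_def rfa)
  moreover have "even (\<bar>q\<bar> + (ceil_div n (snd a) - 1) + (ceil_div n (snd b) - 1) + of_bool (resid n (snd b) < resid n (snd a)))"
    unfolding q_def by auto
  ultimately show ?thesis by (simp add: fa)
qed

lemma inversions_insert:
  assumes "finite E" "p \<notin> E"
  shows "inversions (insert p E) = inversions E + card {q \<in> E. crossed p q}"
proof -
  have "{(p', q). p' \<in> {p} \<and> q \<in> E \<and> crossed p' q} = Pair p ` {q \<in> E. crossed p q}" by auto
  then have "card {(p', q). p' \<in> {p} \<and> q \<in> E \<and> crossed p' q} = card {q \<in> E. crossed p q}"
    by (simp add: card_image inj_on_def)
  then show ?thesis using inversions_Un[of "{p}" E] assms by simp
qed

context pperm
begin

lemma resid_fst_eqE: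
  assumes "a \<in> B" "b \<in> B" "resid n (fst a) = resid n (fst b)" obtains k where "b = tshift n k a"
proof -
  obtain k where "fst b = fst a + k * int n" using resid_eqE[OF n_pos assms(3)] .
  then have "b = tshift n k a" using fst_eqD[OF assms(2) tshift_in[OF assms(1)]] by simp
  then show ?thesis by (rule that)
qed

lemma resid_snd_eqE:
  assumes "a \<in> B" "b \<in> B" "resid n (snd a) = resid n (snd b)" obtains k where "b = tshift n k a"
proof -
  obtain k where "snd b = snd a + k * int n" using resid_eqE[OF n_pos assms(3)] .
  then have "b = tshift n k a" using snd_eqD[OF assms(2) tshift_in[OF assms(1)]] by simp
  then show ?thesis by (rule that)
qed

lemma pgraph_res: "pgraph (res n ` B)"
  unfolding pgraph_def
proof (intro conjI inj_onI)
  have "res n ` B \<subseteq> {1..int n} \<times> {1..int n}"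
    using resid_bounds[OF n_pos] by (auto simp: res_def)
  then show "finite (res n ` B)" by (rule finite_subset) simp
next
  fix x y assume "x \<in> res n ` B" "y \<in> res n ` B" and eq: "fst x = fst y"
  then obtain a b where ab: "x = res n a" "y = res n b" "a \<in> B" "b \<in> B" by blast
  then obtain k where "b = tshift n k a" using resid_fst_eqE[of a b] eq by auto
  then show "x = y" using ab by simp
next
  fix x y assume "x \<in> res n ` B" "y \<in> res n ` B" and eq: "snd x = snd y"
  then obtain a b where ab: "x = res n a" "y = res n b" "a \<in> B" "b \<in> B" by blast
  then obtain k where "b = tshift n k a" using resid_snd_eqE[of a b] eq by auto
  then show "x = y" using ab by simp
qed

lemma transversal_inj:
  assumes "transversal (tshift n) B T"
  shows "inj_on (\<lambda>b. resid n (fst b)) T" "inj_on (\<lambda>b. resid n (snd b)) T"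
proof -
  have "T \<subseteq> B" using assms by (simp add: transversal_def)
  then show "inj_on (\<lambda>b. resid n (fst b)) T" "inj_on (\<lambda>b. resid n (snd b)) T"
    using assms resid_fst_eqE resid_snd_eqE unfolding inj_on_def transversal_def by (metis subsetD)+
qed

text \<open>Each class of pairs is represented by a first ball in the window and a translate of a
  window ball; for \<open>balls w\<close> this is \<open>aff_length_eq\<close>.\<close>

definition affine_inversions :: nat where
  "affine_inversions = (\<Sum>a\<in>win n B. \<Sum>b\<in>win n B. card {k. sNE a (tshift n k b)})"

text \<open>Summation of \<open>card_crossings_parity\<close> over unordered pairs of classes. Each
  class occurs in all but one of the choices of a partner, whence the factor
  \<open>ncls n B - 1\<close>.\<close>

lemma affine_inversions_parity:
  "even (int affine_inversions + int (inversions (res n ` B)) + (int (ncls n B) - 1) * rho_entry n B)"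
proof -
  note tw = transversal_win[OF n_pos tinv_B]
  define al where "al = (\<lambda>b. ceil_div n (snd b) - ceil_div n (fst b))"
  define g where "g = (\<lambda>a b. card {k. sNE a (tshift n k b)})"
  have inj: "inj_on (res n) (win n B)"
    using transversal_inj(1)[OF tw] by (metis (mono_tags, lifting) fst_res inj_on_def)
  have pair: "even (int (g a b) + int (g b a) + al a + al b + of_bool (crossed (res n a) (res n b)))"
    if ab: "a \<in> win n B" "b \<in> win n B" "a \<noteq> b" for a b
  proof -
    have aB: "a \<in> B" "b \<in> B" using ab by (auto simp: win_def)
    have w: "1 \<le> fst a" "fst a \<le> int n" "1 \<le> fst b" "fst b \<le> int n" using ab by (auto simp: win_def)
    have r: "resid n (snd a) \<noteq> resid n (snd b)" using transversal_inj(2)[OF tw] ab by (auto dest: inj_onD)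
    have sym: "crossed x y = crossed y x" for x y by (auto simp: crossed_def)
    have "fst a \<noteq> fst b" using fst_eqD[OF aB] ab(3) by blast
    then show ?thesis
    proof (cases "fst a < fst b")
      case True
      then show ?thesis using card_crossings_parity[OF n_pos w True r] by (simp add: g_def al_def algebra_simps)
    next
      case False
      then have "fst b < fst a" using \<open>fst a \<noteq> fst b\<close> by simp
      then show ?thesis using card_crossings_parity[OF n_pos w(3,4,1,2) _ r[symmetric]]
        by (simp add: g_def al_def algebra_simps sym[of "res n a"])
    qed
  qed
  have gaa: "g a a = 0" for a
  proof -
    have "{k. sNE a (tshift n k a)} = {}" by (auto simp: sNE_def)
    then show ?thesis by (simp add: g_def)
  qed
  \<comment> \<open>Generalised to subsets of the window: a new ball is paired once with every
    earlier one, which raises the multiplicity of each earlier block difference by one.\<close>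
  have "even (int (\<Sum>a\<in>W. \<Sum>b\<in>W. g a b) + int (inversions (res n ` W)) + (int (card W) - 1) * (\<Sum>a\<in>W. al a))"
    if "finite W" "W \<subseteq> win n B" for W
    using that
  proof (induction W rule: finite_induct)
    case empty
    then show ?case by simp
  next
    case (insert x W)
    let ?cr = "card {q \<in> res n ` W. crossed (res n x) q}"
    have IH: "even (int (\<Sum>a\<in>W. \<Sum>b\<in>W. g a b) + int (inversions (res n ` W)) + (int (card W) - 1) * (\<Sum>a\<in>W. al a))"
      using insert by auto
    have injW: "inj_on (res n) (insert x W)" using inj_on_subset[OF inj insert.prems] .
    then have nx: "res n x \<notin> res n ` W" using insert.hyps by (auto dest: inj_onD)
    have inv: "inversions (res n ` insert x W) = inversions (res n ` W) + ?cr"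
      using inversions_insert[of "res n ` W" "res n x"] nx insert.hyps by simp
    have "{q \<in> res n ` W. crossed (res n x) q} = res n ` {b \<in> W. crossed (res n x) (res n b)}" by auto
    then have cr: "?cr = (\<Sum>b\<in>W. of_bool (crossed (res n x) (res n b)))"
      using card_image[OF inj_on_subset[OF injW, of "{b \<in> W. crossed (res n x) (res n b)}"]] insert.hyps
      by (auto simp: Int_def)
    have S: "(\<Sum>a\<in>insert x W. \<Sum>b\<in>insert x W. g a b)
      = (\<Sum>a\<in>W. \<Sum>b\<in>W. g a b) + (\<Sum>b\<in>W. g x b + g b x)"
      using insert.hyps by (simp add: gaa sum.distrib)
    have "even (\<Sum>b\<in>W. int (g x b) + int (g b x) + al x + al b + of_bool (crossed (res n x) (res n b)))"
      by (rule dvd_sum, rule pair) (use insert in auto)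
    then have ev: "even (int (\<Sum>b\<in>W. g x b + g b x) + int (card W) * al x + (\<Sum>b\<in>W. al b) + int ?cr)"
      unfolding cr by (simp only: sum.distrib of_nat_sum of_nat_add of_nat_of_bool sum_constant mult.commute) 
    have "int (\<Sum>a\<in>insert x W. \<Sum>b\<in>insert x W. g a b) + int (inversions (res n ` insert x W))
       + (int (card (insert x W)) - 1) * (\<Sum>a\<in>insert x W. al a)
      = (int (\<Sum>a\<in>W. \<Sum>b\<in>W. g a b) + int (inversions (res n ` W)) + (int (card W) - 1) * (\<Sum>a\<in>W. al a))
       + (int (\<Sum>b\<in>W. g x b + g b x) + int (card W) * al x + (\<Sum>b\<in>W. al b) + int ?cr)"
      unfolding S inv using insert.hyps by (simp add: algebra_simps)
    then show ?case using IH ev by (simp only: dvd_add)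
  qed
  from this[OF finite_win[OF subset_refl] subset_refl] show ?thesis
    unfolding affine_inversions_def rho_entry_transversal[OF n_pos tw] ncls_transversal[OF tw]
      res_transversal[OF tw] g_def al_def .
qed

end


section \<open>One step of the algorithm\<close>

text \<open>Columns decrease as rows increase, so the column of the last row, used by the back
  corner, is the westernmost.\<close>

lemma back_corner_le:
  assumes "finite D" "inj_on fst D" "inj_on snd D"
    and anti: "\<And>a b. a \<in> D \<Longrightarrow> b \<in> D \<Longrightarrow> fst a < fst b \<Longrightarrow> snd b < snd a" and a: "a \<in> D"
  shows "fst (back_corner D) \<le> fst a" "snd (back_corner D) \<le> snd a"
proof -
  obtain bs where bs: "set bs = D" "row_sorted bs" using ex_row_sorted[OF assms(1,2)] .
  have ne: "bs \<noteq> []" using bs(1) a by auto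
  let ?l = "length bs - 1"
  obtain i where i: "i < length bs" "a = bs ! i" using a bs(1) by (metis in_set_conv_nth)
  have b: "back_corner D = (fst (bs ! 0), snd (bs ! ?l))"
    using back_corner_list[OF bs(2) ne] bs(1) ne by (simp add: hd_conv_nth last_conv_nth)
  show "fst (back_corner D) \<le> fst a"
    using b i row_sorted_nth[OF bs(2), of 0 i] by (cases "i = 0") auto
  have "i = ?l \<or> i < ?l" using i by linarith
  then show "snd (back_corner D) \<le> snd a"
  proof
    assume "i < ?l"
    then have "fst a < fst (bs ! ?l)" using row_sorted_nth[OF bs(2), of i ?l] i ne by simp
    moreover have "bs ! ?l \<in> D" using bs(1) ne by auto
    ultimately have "snd (bs ! ?l) < snd a" using anti[OF a] by blast
    then show ?thesis using b by simp
  qed (use b i in simp)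
qed

context pperm
begin

lemma pperm_subset: "X \<subseteq> B \<Longrightarrow> tinv n X \<Longrightarrow> pperm n X"
  using n_pos inj_fst inj_snd by unfold_locales (auto intro: inj_on_subset)

lemma rho_entry_win: "rho_entry n B = (\<Sum>b\<in>win n B. ceil_div n (snd b)) - (\<Sum>b\<in>win n B. ceil_div n (fst b))"
  by (simp add: rho_entry_transversal[OF n_pos transversal_win[OF n_pos tinv_B]] sum_subtractf)

context
  assumes nonempty: "B \<noteq> {}"
begin

lemmas level_mono = dval_mono[OF nonempty] and level_shift = dval_tshift[OF nonempty] and level_pred = dval_pred[OF nonempty]

lemma int_channel_size_pos: "int channel_size > 0"
  using channel_size_pos[OF nonempty] by simp

lemma level_iff: "b \<in> level n B t \<longleftrightarrow> b \<in> B \<and> dval n B b = t"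
  by (auto simp: level_def)

lemma level_tshift: "level n B (t + k * int channel_size) = tshift n k ` level n B t"
proof (intro set_eqI iffI)
  fix b assume b: "b \<in> level n B (t + k * int channel_size)"
  then have "tshift n (- k) b \<in> level n B t" by (simp add: level_iff tshift_in level_shift)
  then show "b \<in> tshift n k ` level n B t" by (intro image_eqI[of _ _ "tshift n (- k) b"]) auto
qed (auto simp: level_iff tshift_in level_shift)

text \<open>Each translation step changes d by \<open>channel_size\<close>. Consequently residues of
  rows or of columns separate the balls of \<open>channel_size\<close> consecutive levels.\<close>

lemma same_class_dval:
  assumes "a \<in> B" "b \<in> B" "b = tshift n k a" "\<bar>dval n B b - dval n B a\<bar> < int channel_size"
  shows "a = b"
proof -
  have "k = 0" using assms level_shift[OF assms(1), of k] by (intro zero_shift_if_close[of "dval n B b" "dval n B a" k channel_size]) auto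
  then show ?thesis using assms(3) by simp
qed

lemma resid_fst_dval:
  assumes "a \<in> B" "b \<in> B" "resid n (fst a) = resid n (fst b)" "\<bar>dval n B b - dval n B a\<bar> < int channel_size"
  shows "a = b"
  using resid_fst_eqE[OF assms(1-3)] same_class_dval[OF assms(1,2) _ assms(4)] by blast

lemma resid_snd_dval:
  assumes "a \<in> B" "b \<in> B" "resid n (snd a) = resid n (snd b)" "\<bar>dval n B b - dval n B a\<bar> < int channel_size"
  shows "a = b"
  using resid_snd_eqE[OF assms(1-3)] same_class_dval[OF assms(1,2) _ assms(4)] by blast

lemma level_resid_inj: "inj_on (\<lambda>b. resid n (fst b)) (level n B t)" "inj_on (\<lambda>b. resid n (snd b)) (level n B t)"
  using resid_fst_dval resid_snd_dval int_channel_size_pos by (auto simp: inj_on_def level_iff)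

lemma level_inj: "inj_on fst (level n B t)" "inj_on snd (level n B t)"
  using level_resid_inj[of t] by (auto simp: inj_on_def)

text \<open>The rows of a level have distinct residues modulo n.\<close>

lemma finite_level: "finite (level n B t)"
  by (rule inj_on_finite[OF level_resid_inj(1), of t "{1..int n}"]) (use resid_bounds[OF n_pos] in auto)

lemma level_antichain:
  assumes "a \<in> level n B t" "b \<in> level n B t" "fst a < fst b" shows "snd b < snd a"
proof -
  have "snd a \<noteq> snd b" using assms level_inj(2)[of t] by (auto dest: inj_onD)
  moreover have "\<not> sNW a b" using level_mono[of a b] assms by (auto simp: level_iff)
  ultimately show ?thesis using assms(3) by (auto simp: sNW_def)
qed

lemma dval_down:
  assumes "b \<in> B" shows "\<exists>a\<in>B. dval n B a = dval n B b - int (Suc k) \<and> sNW a b"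
proof (induction k)
  case 0
  then show ?case using level_pred[OF assms] by auto
next
  case (Suc k)
  then obtain a where a: "a \<in> B" "dval n B a = dval n B b - int (Suc k)" "sNW a b" by blast
  obtain c where "c \<in> B" "sNW c a" "dval n B c = dval n B a - 1" using level_pred[OF a(1)] by blast
  then show ?case using a by (intro bexI[of _ c]) (auto simp: sNW_def)
qed

lemma level_below:
  assumes "b \<in> level n B t" "s < t" obtains a where "a \<in> level n B s" "sNW a b"
proof -
  have "dval n B b - int (Suc (nat (t - s - 1))) = s" using assms by (simp add: level_iff)
  then obtain a where "a \<in> B" "dval n B a = s" "sNW a b"
    using dval_down[of b "nat (t - s - 1)"] assms(1) by (auto simp: level_iff)
  then show ?thesis using that by (simp add: level_iff)
qed

text \<open>A ball translated far enough southeast has a value above \<open>t\<close>, and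
  \<open>level_below\<close> descends from it. Hence there is a back corner for every
  integer.\<close>

lemma level_nonempty: "level n B t \<noteq> {}"
proof -
  obtain b where b: "b \<in> B" using nonempty by blast
  define k where "k = \<bar>t\<bar> + \<bar>dval n B b\<bar> + 1"
  have "k * 1 \<le> k * int channel_size" using int_channel_size_pos by (intro mult_left_mono) (auto simp: k_def)
  moreover have "t < dval n B b + k" by (simp add: k_def)
  ultimately have "t < dval n B (tshift n k b)" unfolding level_shift[OF b] by linarith
  moreover have "tshift n k b \<in> level n B (dval n B (tshift n k b))" using b by (simp add: level_iff tshift_in)
  ultimately show ?thesis using level_below by blast
qed

abbreviation level_reps :: "int set" where "level_reps \<equiv> {0..<int channel_size}"

lemma level_reps_unique: "s \<in> level_reps \<Longrightarrow> t \<in> level_reps \<Longrightarrow> s = t + k * int channel_size \<Longrightarrow> k = 0"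
  by (rule zero_shift_if_close[of s t k channel_size]) auto

lemma level_reps_ex: "\<exists>k. t + k * int channel_size \<in> level_reps"
proof -
  have "t + (- (t div int channel_size)) * int channel_size = t mod int channel_size"
    by (simp add: minus_div_mult_eq_mod)
  then show ?thesis using int_channel_size_pos by (intro exI[of _ "- (t div int channel_size)"]) auto
qed

lemma level_disjoint: "s \<noteq> t \<Longrightarrow> level n B s \<inter> level n B t = {}"
  by (auto simp: level_iff)

lemma transversal_levels: "transversal (tshift n) B (\<Union>t\<in>level_reps. level n B t)"
  unfolding transversal_def
proof (intro conjI ballI allI impI)
  fix x assume x: "x \<in> B"
  obtain k where "dval n B x + k * int channel_size \<in> level_reps" using level_reps_ex by blast
  then show "\<exists>k. tshift n k x \<in> (\<Union>t\<in>level_reps. level n B t)"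
    using x by (intro exI[of _ k]) (auto simp: level_iff tshift_in level_shift)
next
  fix x k assume x: "x \<in> (\<Union>t\<in>level_reps. level n B t)" "tshift n k x \<in> (\<Union>t\<in>level_reps. level n B t)"
  then have xB: "x \<in> B" and d: "dval n B x \<in> level_reps" "dval n B (tshift n k x) \<in> level_reps" by (auto simp: level_iff)
  have "k = 0" by (rule level_reps_unique[OF d(2,1) level_shift[OF xB]])
  then show "tshift n k x = x" by simp
qed (auto simp: level_iff)

section \<open>The rotated levels: \<open>fw\<close> and the back corners together\<close>

definition rotated :: "int \<Rightarrow> ball set" where "rotated t = rotate_level (level n B t)"

lemmas rotated_props = rotate_level_props[OF finite_level level_nonempty level_inj, folded rotated_def]

lemma rotated_tshift: "rotated (t + k * int channel_size) = tshift n k ` rotated t"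
  unfolding rotated_def rotate_level_def level_tshift
  using corners_tshift[OF finite_level level_inj(1)] level_nonempty by simp

lemma rotated_fst_unique:
  assumes "x \<in> rotated s" "y \<in> rotated t" "fst x = fst y" shows "s = t" "x = y"
proof -
  have "fst x \<in> fst ` level n B s" "fst y \<in> fst ` level n B t"
    using assms rotated_props(2) by (metis imageI)+
  then obtain a b where "a \<in> level n B s" "b \<in> level n B t" "fst a = fst b" using assms(3) by auto
  then show st: "s = t" using fst_eqD[of a b] by (auto simp: level_iff)
  show "x = y" using rotated_props(1)[of s] assms st by (auto simp: pgraph_def dest: inj_onD)
qed

lemma rotated_snd_unique:
  assumes "x \<in> rotated s" "y \<in> rotated t" "snd x = snd y" shows "x = y"
proof -
  have "snd x \<in> snd ` level n B s" "snd y \<in> snd ` level n B t"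
    using assms rotated_props(3) by (metis imageI)+
  then obtain a b where "a \<in> level n B s" "b \<in> level n B t" "snd a = snd b" using assms(3) by auto
  then have st: "s = t" using snd_eqD[of a b] by (auto simp: level_iff)
  show "x = y" using rotated_props(1)[of s] assms st by (auto simp: pgraph_def dest: inj_onD)
qed

text \<open>The intermediate object between \<open>B\<close> and \<open>fw n B\<close>: a partial
  permutation with the rows and columns of \<open>B\<close>, and the disjoint union of
  \<open>fw n B\<close> and \<open>backS n B\<close>.\<close>

definition rotated_balls :: "ball set" where "rotated_balls = (\<Union>t. rotated t)"

lemma backS_eq: "backS n B = (\<Union>t. {back_corner (level n B t)})"
  unfolding backS_def using level_nonempty by blast

lemma rotated_balls_split: "rotated_balls = fw n B \<union> backS n B"
  unfolding rotated_balls_def rotated_def rotate_level_def fw_def backS_eq by blast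

lemma fw_backS_disjoint: "fw n B \<inter> backS n B = {}"
proof -
  have "x \<noteq> back_corner (level n B t)" if x: "x \<in> outer_corners (level n B s)" for x s t
  proof
    assume e: "x = back_corner (level n B t)"
    have "x \<in> rotated s" "x \<in> rotated t" using x e by (auto simp: rotated_def rotate_level_def)
    then have "s = t" using rotated_fst_unique by blast
    then show False using x e rotated_props(4) by blast
  qed
  then show ?thesis unfolding fw_def backS_eq by blast
qed

lemma pperm_rotated_balls: "pperm n rotated_balls"
proof
  show "tinv n rotated_balls"
    unfolding tinv_def
  proof (intro ballI allI)
    fix x k assume "x \<in> rotated_balls"
    then obtain t where "x \<in> rotated t" by (auto simp: rotated_balls_def)
    then have "tshift n k x \<in> rotated (t + k * int channel_size)" unfolding rotated_tshift by blast
    then show "tshift n k x \<in> rotated_balls" unfolding rotated_balls_def by blast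
  qed
  show "inj_on fst rotated_balls" "inj_on snd rotated_balls"
    unfolding inj_on_def rotated_balls_def using rotated_fst_unique(2) rotated_snd_unique by blast+
qed (rule n_pos)

lemma tinv_backS: "tinv n (backS n B)"
  unfolding tinv_def
proof (intro ballI allI)
  fix x k assume "x \<in> backS n B"
  then obtain t where "x = back_corner (level n B t)" by (auto simp: backS_eq)
  then have "tshift n k x = back_corner (level n B (t + k * int channel_size))"
    unfolding level_tshift using corners_tshift(2)[OF finite_level level_inj(1) level_nonempty] by simp
  then show "tshift n k x \<in> backS n B" unfolding backS_eq by blast
qed

lemma tinv_fw: "tinv n (fw n B)"
  unfolding tinv_def
proof (intro ballI allI)
  fix x k assume "x \<in> fw n B"
  then obtain t where "x \<in> outer_corners (level n B t)" by (auto simp: fw_def)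
  then have "tshift n k x \<in> outer_corners (level n B (t + k * int channel_size))"
    unfolding level_tshift using corners_tshift(1)[OF finite_level level_inj(1)] by simp
  then show "tshift n k x \<in> fw n B" unfolding fw_def by blast
qed

lemma pperm_fw: "pperm n (fw n B)" and pperm_backS: "pperm n (backS n B)"
  using pperm.pperm_subset[OF pperm_rotated_balls] rotated_balls_split tinv_fw tinv_backS by blast+

lemma rotated_balls_images: "fst ` rotated_balls = fst ` B" "snd ` rotated_balls = snd ` B"
proof -
  have "(\<Union>t. level n B t) = B" by (auto simp: level_iff)
  then have "f ` B = (\<Union>t. f ` level n B t)" for f :: "ball \<Rightarrow> int" by (metis image_UN)
  then show "fst ` rotated_balls = fst ` B" "snd ` rotated_balls = snd ` B"
    unfolding rotated_balls_def image_UN rotated_props by simp_all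
qed

lemma transversal_rotated_balls: "transversal (tshift n) rotated_balls (\<Union>t\<in>level_reps. rotated t)"
  unfolding transversal_def
proof (intro conjI ballI allI impI)
  fix x assume "x \<in> rotated_balls"
  then obtain t where t: "x \<in> rotated t" by (auto simp: rotated_balls_def)
  obtain k where "t + k * int channel_size \<in> level_reps" using level_reps_ex by blast
  moreover have "tshift n k x \<in> rotated (t + k * int channel_size)" unfolding rotated_tshift using t by blast
  ultimately show "\<exists>k. tshift n k x \<in> (\<Union>t\<in>level_reps. rotated t)" by blast
next
  fix x k assume x: "x \<in> (\<Union>t\<in>level_reps. rotated t)" "tshift n k x \<in> (\<Union>t\<in>level_reps. rotated t)"
  obtain t s where t: "t \<in> level_reps" "x \<in> rotated t" and s: "s \<in> level_reps" "tshift n k x \<in> rotated s" using x by blast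
  have "tshift n k x \<in> rotated (t + k * int channel_size)" unfolding rotated_tshift using t by blast
  then have "s = t + k * int channel_size" using rotated_fst_unique(1)[OF s(2)] by blast
  then have "k = 0" by (rule level_reps_unique[OF s(1) t(1)])
  then show "tshift n k x = x" by simp
qed (auto simp: rotated_balls_def)

lemma card_rotated: "card (rotated t) = card (level n B t)"
  using card_image[of fst "rotated t"] card_image[OF level_inj(1)[of t]] rotated_props(1,2)[of t]
  by (simp add: pgraph_def)

lemma ncls_levels: "ncls n B = (\<Sum>t\<in>level_reps. card (level n B t))"
  unfolding ncls_transversal[OF transversal_levels]
  by (rule card_UN_disjoint) (use finite_level level_disjoint in auto)

lemma ncls_rotated_balls: "ncls n rotated_balls = ncls n B"
proof -
  have "ncls n rotated_balls = (\<Sum>t\<in>level_reps. card (rotated t))"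
    unfolding ncls_transversal[OF transversal_rotated_balls]
  proof (rule card_UN_disjoint)
    show "\<forall>i\<in>level_reps. \<forall>j\<in>level_reps. i \<noteq> j \<longrightarrow> rotated i \<inter> rotated j = {}" using rotated_fst_unique(1) by blast
  qed (use rotated_props(1) in \<open>auto simp: pgraph_def\<close>)
  then show ?thesis by (simp add: ncls_levels card_rotated)
qed

lemma back_corner_rotated: "back_corner (level n B t) \<in> rotated t"
  by (simp add: rotated_def rotate_level_def)

text \<open>Each level has one back corner, and there are \<open>channel_size\<close> levels up to
  translation.\<close>

lemma ncls_backS: "ncls n (backS n B) = channel_size"
proof -
  let ?b = "\<lambda>t. back_corner (level n B t)"
  have "transversal (tshift n) (backS n B) (?b ` level_reps)"
    unfolding transversal_def
  proof (intro conjI ballI allI impI)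
    fix x assume "x \<in> backS n B"
    then obtain t where t: "x = ?b t" by (auto simp: backS_eq)
    obtain k where k: "t + k * int channel_size \<in> level_reps" using level_reps_ex by blast
    have "tshift n k x = ?b (t + k * int channel_size)"
      unfolding level_tshift t using corners_tshift(2)[OF finite_level level_inj(1) level_nonempty] by simp
    then show "\<exists>k. tshift n k x \<in> ?b ` level_reps" using k by (intro exI[of _ k]) (metis imageI)
  next
    fix x k assume "x \<in> ?b ` level_reps" "tshift n k x \<in> ?b ` level_reps"
    then obtain s t where "s \<in> level_reps" "t \<in> level_reps" "x = ?b s" "tshift n k x = ?b t" by blast
    then have "x \<in> (\<Union>t\<in>level_reps. rotated t)" "tshift n k x \<in> (\<Union>t\<in>level_reps. rotated t)"
      using back_corner_rotated[of s] back_corner_rotated[of t] by auto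
    then show "tshift n k x = x" using transversal_rotated_balls unfolding transversal_def by blast
  qed (auto simp: backS_eq)
  moreover have "inj_on ?b level_reps"
    using rotated_fst_unique(1)[OF back_corner_rotated back_corner_rotated] by (auto simp: inj_on_def)
  ultimately show ?thesis using ncls_transversal card_image[of ?b level_reps] by simp
qed

lemma win_rotated_balls: "win n rotated_balls = win n (fw n B) \<union> win n (backS n B)" "win n (fw n B) \<inter> win n (backS n B) = {}"
  using fw_backS_disjoint unfolding rotated_balls_split by (auto simp: win_def)

lemma finite_win_fw: "finite (win n (fw n B))" "finite (win n (backS n B))"
  using pperm.finite_win[OF pperm_fw] pperm.finite_win[OF pperm_backS] by auto

text \<open>Rotation keeps the number of classes and the back corners are then removed. As
  \<open>channel_size\<close> is positive, this measure makes the induction terminate.\<close>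

lemma ncls_fw: "ncls n B = ncls n (fw n B) + channel_size"
  using card_Un_disjoint[OF finite_win_fw win_rotated_balls(2)] ncls_rotated_balls ncls_backS
    ncls_win[OF n_pos tinv_fw] ncls_win[OF n_pos tinv_backS] ncls_win[OF n_pos pperm.tinv_B[OF pperm_rotated_balls]]
  by (simp add: win_rotated_balls(1))

text \<open>\<open>rho_entry\<close> is a sum over columns minus a sum over rows, and a rotation
  only changes which row is paired with which column.\<close>

lemma rho_step: "rho_entry n B = rho_entry n (fw n B) + rho_entry n (backS n B)"
proof -
  let ?T = "\<Union>t\<in>level_reps. level n B t" and ?U = "\<Union>t\<in>level_reps. rotated t"
  have img: "fst ` ?U = fst ` ?T" "snd ` ?U = snd ` ?T" by (simp_all add: image_UN rotated_props)
  have sub: "?T \<subseteq> B" "?U \<subseteq> rotated_balls" by (auto simp: level_iff rotated_balls_def)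
  note iT = inj_on_subset[OF inj_fst sub(1)] inj_on_subset[OF inj_snd sub(1)]
  note iU = inj_on_subset[OF pperm.inj_fst[OF pperm_rotated_balls] sub(2)] inj_on_subset[OF pperm.inj_snd[OF pperm_rotated_balls] sub(2)]
  have re: "(\<Sum>x\<in>?U. ceil_div n (fst x)) = (\<Sum>x\<in>?T. ceil_div n (fst x))"
    "(\<Sum>x\<in>?U. ceil_div n (snd x)) = (\<Sum>x\<in>?T. ceil_div n (snd x))"
    using sum.reindex[OF iT(1), of "ceil_div n"] sum.reindex[OF iU(1), of "ceil_div n"]
      sum.reindex[OF iT(2), of "ceil_div n"] sum.reindex[OF iU(2), of "ceil_div n"]
    unfolding img by (simp_all add: o_def)
  have "rho_entry n B = rho_entry n rotated_balls"
    unfolding rho_entry_transversal[OF n_pos transversal_levels] rho_entry_transversal[OF n_pos transversal_rotated_balls]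
      sum_subtractf re ..
  also have "\<dots> = rho_entry n (fw n B) + rho_entry n (backS n B)"
    unfolding pperm.rho_entry_win[OF pperm_rotated_balls] pperm.rho_entry_win[OF pperm_fw]
      pperm.rho_entry_win[OF pperm_backS] win_rotated_balls(1)
      sum.union_disjoint[OF finite_win_fw win_rotated_balls(2)] by simp
  finally show ?thesis .
qed

text \<open>For s < t, the ball of level t in the row of its back corner has a ball of level s
  strictly northwest of it, and the back corner of level s is no lower than that ball. The same
  argument in columns shows that the back corners form a strict northwest chain.\<close>

lemma backS_no_sNE: "x \<in> backS n B \<Longrightarrow> y \<in> backS n B \<Longrightarrow> \<not> sNE x y"
proof -
  let ?b = "\<lambda>t. back_corner (level n B t)"
  have less: "sNW (?b s) (?b t)" if st: "s < t" for s t
  proof -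
    obtain b c where bc: "b \<in> level n B t" "fst b = fst (?b t)" "c \<in> level n B t" "snd c = snd (?b t)"
      using rotated_props(5,6)[of t] by (metis imageE)
    obtain a where a: "a \<in> level n B s" "sNW a b" using level_below[OF bc(1) st] .
    obtain d where d: "d \<in> level n B s" "sNW d c" using level_below[OF bc(3) st] .
    have "fst (?b s) \<le> fst a" "snd (?b s) \<le> snd d"
      using back_corner_le[OF finite_level level_inj, of s a] back_corner_le[OF finite_level level_inj, of s d]
        level_antichain[of _ s] a(1) d(1) by blast+
    then show ?thesis using a d bc by (simp add: sNW_def)
  qed
  assume "x \<in> backS n B" "y \<in> backS n B"
  then obtain s t where "x = ?b s" "y = ?b t" by (auto simp: backS_eq)
  then show "\<not> sNE x y" using less[of s t] less[of t s]
    by (cases s t rule: linorder_cases) (auto simp: sNE_def sNW_def)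
qed

text \<open>\<open>affine_inversions_parity\<close> for the back corners, whose affine inversions
  vanish.\<close>

lemma backS_parity:
  "even (int (inversions (res n ` backS n B)) + (int channel_size - 1) * rho_entry n (backS n B))"
proof -
  interpret S: pperm n "backS n B" by (rule pperm_backS)
  have "{k. sNE a (tshift n k b)} = {}" if "a \<in> win n (backS n B)" "b \<in> win n (backS n B)" for a b
    using that backS_no_sNE[of a] S.tshift_in[of b] by (auto simp: win_def)
  then have "S.affine_inversions = 0" unfolding S.affine_inversions_def by simp
  then show ?thesis using S.affine_inversions_parity unfolding ncls_backS by simp
qed

text \<open>A level of c balls is rotated by a cycle of sign exponent c - 1. Summed over the levels
  up to translation this is \<open>ncls n B - channel_size\<close>, the number of classes of
  \<open>fw n B\<close>.\<close>

lemma rotate_parity: "even (inversions (res n ` B) + inversions (res n ` rotated_balls) + ncls n (fw n B))"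
proof -
  interpret Q: pperm n rotated_balls by (rule pperm_rotated_balls)
  let ?X = "\<lambda>t. res n ` level n B t" and ?Y = "\<lambda>t. res n ` rotated t"
  have fs: "fst ` res n ` A = resid n ` fst ` A" "snd ` res n ` A = resid n ` snd ` A" for A
    by (simp_all add: image_image)
  have close: "\<bar>dval n B b - dval n B a\<bar> < int channel_size" if "s \<in> level_reps" "t \<in> level_reps" "a \<in> level n B s" "b \<in> level n B t" for a b s t
    using that by (auto simp: level_iff)
  have "even (inversions (\<Union>t\<in>level_reps. ?X t) + inversions (\<Union>t\<in>level_reps. ?Y t) + (\<Sum>t\<in>level_reps. card (level n B t) - 1))
    \<and> pgraph (\<Union>t\<in>level_reps. ?X t) \<and> pgraph (\<Union>t\<in>level_reps. ?Y t)"
  proof (rule inversions_UN)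
    fix t
    show "pgraph (?X t)" by (rule pgraph_subset[OF pgraph_res]) (auto simp: level_iff)
    show "pgraph (?Y t)" by (rule pgraph_subset[OF Q.pgraph_res]) (auto simp: rotated_balls_def)
    show "fst ` ?Y t = fst ` ?X t" "snd ` ?Y t = snd ` ?X t" unfolding fs rotated_props by simp_all
    show "even (inversions (?X t) + inversions (?Y t) + (card (level n B t) - 1))"
      unfolding res_def rotated_def
      by (rule rotate_level_inversions[OF finite_level level_nonempty level_resid_inj])
  next
    fix s t assume st: "s \<in> level_reps" "t \<in> level_reps" "s \<noteq> t"
    show "fst ` ?X s \<inter> fst ` ?X t = {}"
    proof (rule ccontr)
      assume "fst ` ?X s \<inter> fst ` ?X t \<noteq> {}"
      then obtain a b where ab: "a \<in> level n B s" "b \<in> level n B t" "resid n (fst a) = resid n (fst b)"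
        unfolding fs by blast
      then have "a = b" using resid_fst_dval[of a b] close[OF st(1,2) ab(1,2)] by (auto simp: level_iff)
      then show False using ab st(3) by (auto simp: level_iff)
    qed
    show "snd ` ?X s \<inter> snd ` ?X t = {}"
    proof (rule ccontr)
      assume "snd ` ?X s \<inter> snd ` ?X t \<noteq> {}"
      then obtain a b where ab: "a \<in> level n B s" "b \<in> level n B t" "resid n (snd a) = resid n (snd b)"
        unfolding fs by blast
      then have "a = b" using resid_snd_dval[of a b] close[OF st(1,2) ab(1,2)] by (auto simp: level_iff)
      then show False using ab st(3) by (auto simp: level_iff)
    qed
  qed simp
  moreover have "res n ` B = (\<Union>t\<in>level_reps. ?X t)" "res n ` rotated_balls = (\<Union>t\<in>level_reps. ?Y t)"
    using res_transversal[OF transversal_levels] res_transversal[OF transversal_rotated_balls] by (simp_all add: image_UN)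
  moreover have "(\<Sum>t\<in>level_reps. card (level n B t) - 1) = ncls n (fw n B)"
  proof -
    have "card (level n B t) = (card (level n B t) - 1) + 1" for t
      using level_nonempty[of t] finite_level[of t] card_gt_0_iff[of "level n B t"] by simp
    then have "(\<Sum>t\<in>level_reps. card (level n B t)) = (\<Sum>t\<in>level_reps. (card (level n B t) - 1) + 1)"
      by (rule sum.cong[OF refl])
    also have "\<dots> = (\<Sum>t\<in>level_reps. card (level n B t) - 1) + channel_size" by (simp only: sum.distrib) simp
    finally show ?thesis using ncls_levels ncls_fw by simp
  qed
  ultimately show ?thesis by simp
qed

text \<open>Inside the partial permutation \<open>rotated_balls\<close> equal residues mean
  translates, and the back corners are an invariant set disjoint from \<open>fw n B\<close>.\<close>

lemma resid_fw_backS_disjoint: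
  "resid n ` fst ` fw n B \<inter> resid n ` fst ` backS n B = {}"
  "resid n ` snd ` fw n B \<inter> resid n ` snd ` backS n B = {}"
proof -
  interpret Q: pperm n rotated_balls by (rule pperm_rotated_balls)
  interpret S: pperm n "backS n B" by (rule pperm_backS)
  have no: "b \<noteq> tshift n k a" if "a \<in> backS n B" "b \<in> fw n B" for a b k
    using S.tshift_in[OF that(1), of k] that(2) fw_backS_disjoint by blast
  have sub: "a \<in> backS n B \<Longrightarrow> a \<in> rotated_balls" "b \<in> fw n B \<Longrightarrow> b \<in> rotated_balls" for a b by (auto simp: rotated_balls_split)
  have "resid n (fst a) \<noteq> resid n (fst b)" "resid n (snd a) \<noteq> resid n (snd b)"
    if ab: "a \<in> backS n B" "b \<in> fw n B" for a b
    using Q.resid_fst_eqE[OF sub(1)[OF ab(1)] sub(2)[OF ab(2)]]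
      Q.resid_snd_eqE[OF sub(1)[OF ab(1)] sub(2)[OF ab(2)]] no[OF ab] by blast+
  then show "resid n ` fst ` fw n B \<inter> resid n ` fst ` backS n B = {}"
    "resid n ` snd ` fw n B \<inter> resid n ` snd ` backS n B = {}" by (fastforce)+
qed

text \<open>Rotation costs the last term, and splitting off the back corners costs the two
  \<open>ltpairs\<close>. There \<open>fw n B\<close> stands first because its residues fill the
  lower rows of the tabloids.\<close>

lemma step_parity:
  "even (inversions (res n ` B) + inversions (res n ` fw n B) + inversions (res n ` backS n B)
    + ltpairs (resid n ` fst ` fw n B) (resid n ` fst ` backS n B)
    + ltpairs (resid n ` snd ` fw n B) (resid n ` snd ` backS n B) + ncls n (fw n B))"
proof -
  interpret Q: pperm n rotated_balls by (rule pperm_rotated_balls)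
  let ?F = "res n ` fw n B" and ?S = "res n ` backS n B"
  have fs: "fst ` res n ` A = resid n ` fst ` A" "snd ` res n ` A = resid n ` snd ` A" for A
    by (simp_all add: image_image)
  have e: "res n ` rotated_balls = ?F \<union> ?S" by (simp add: rotated_balls_split image_Un)
  have "fst ` ?F \<inter> fst ` ?S = {}" unfolding fs by (rule resid_fw_backS_disjoint)
  then have "?F \<inter> ?S = {}" by blast
  then have p: "even (inversions (res n ` rotated_balls) + inversions ?F + inversions ?S
    + ltpairs (resid n ` fst ` fw n B) (resid n ` fst ` backS n B)
    + ltpairs (resid n ` snd ` fw n B) (resid n ` snd ` backS n B))"
    using inversions_Un_parity[of ?F ?S] Q.pgraph_res unfolding e fs by blast
  have *: "even (a + s + c) \<Longrightarrow> even (s + f + g + x + y) \<Longrightarrow> even (a + f + g + x + y + c)"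
    for a s c f g x y :: nat unfolding even_add by sat
  show ?thesis by (rule *[OF rotate_parity p])
qed

lemma fw_images:
  "resid n ` fst ` B = resid n ` fst ` backS n B \<union> resid n ` fst ` fw n B"
  "resid n ` snd ` B = resid n ` snd ` backS n B \<union> resid n ` snd ` fw n B"
  unfolding rotated_balls_images[symmetric] rotated_balls_split by (auto simp: image_Un)

end

end


section \<open>The sign formula\<close>

text \<open>A pair not counted in \<open>Ts\<close> has its larger entry in the new top row and its
  smaller entry anywhere below.\<close>

lemma tabloid_inv_Cons:
  assumes fin: "finite A" "\<And>C. C \<in> set Ts \<Longrightarrow> finite C" and dj: "\<Union>(set Ts) \<inter> A = {}"
  shows "tabloid_inv (A # Ts) = tabloid_inv Ts + ltpairs (\<Union>(set Ts)) A"
proof -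
  let ?I = "\<lambda>T. {(i::int, j). i < j \<and> (\<exists>r s. r < length T \<and> s < length T \<and> i \<in> T ! r \<and> j \<in> T ! s \<and> s < r)}"
  let ?L = "{(i, j). i \<in> \<Union>(set Ts) \<and> j \<in> A \<and> i < j}"
  have U: "x \<in> \<Union>(set Ts) \<longleftrightarrow> (\<exists>r<length Ts. x \<in> Ts ! r)" for x
    by (metis Union_iff in_set_conv_nth)
  have sub: "?I Ts \<subseteq> \<Union>(set Ts) \<times> \<Union>(set Ts)"
  proof
    fix z assume "z \<in> ?I Ts"
    then obtain i j r s where z: "z = (i, j)" "r < length Ts" "s < length Ts" "i \<in> Ts ! r" "j \<in> Ts ! s"
      by blast
    then have "i \<in> \<Union>(set Ts)" "j \<in> \<Union>(set Ts)" unfolding U by blast+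
    then show "z \<in> \<Union>(set Ts) \<times> \<Union>(set Ts)" using z(1) by blast
  qed
  have e: "?I (A # Ts) = ?I Ts \<union> ?L"
  proof (intro set_eqI iffI)
    fix z assume "z \<in> ?I (A # Ts)"
    then obtain i j r s where z: "z = (i, j)" "i < j" "r < length (A # Ts)" "s < length (A # Ts)"
      "i \<in> (A # Ts) ! r" "j \<in> (A # Ts) ! s" "s < r" by blast
    then obtain r' where r: "r = Suc r'" "r' < length Ts" "i \<in> Ts ! r'" by (cases r) auto
    show "z \<in> ?I Ts \<union> ?L"
    proof (cases s)
      case 0
      then have "j \<in> A" "i \<in> \<Union>(set Ts)" using z r unfolding U by auto
      then show ?thesis using z by blast
    next
      case (Suc s')
      then have "s' < length Ts" "j \<in> Ts ! s'" "s' < r'" using z r by auto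
      then show ?thesis using z(1,2) r by blast
    qed
  next
    fix z assume "z \<in> ?I Ts \<union> ?L"
    then show "z \<in> ?I (A # Ts)"
    proof
      assume "z \<in> ?I Ts"
      then obtain i j r s where z: "z = (i, j)" "i < j" "r < length Ts" "s < length Ts"
        "i \<in> Ts ! r" "j \<in> Ts ! s" "s < r" by blast
      then have "i \<in> (A # Ts) ! Suc r \<and> j \<in> (A # Ts) ! Suc s" by simp
      then show ?thesis using z by (metis (mono_tags, lifting) Suc_less_eq case_prodI length_Cons mem_Collect_eq)
    next
      assume "z \<in> ?L"
      then obtain i j r where z: "z = (i, j)" "i < j" "j \<in> A" "r < length Ts" "i \<in> Ts ! r"
        unfolding U by auto
      then have "i \<in> (A # Ts) ! Suc r \<and> j \<in> (A # Ts) ! 0" by simp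
      then show ?thesis using z by (metis (mono_tags, lifting) Suc_less_eq case_prodI length_Cons mem_Collect_eq zero_less_Suc)
    qed
  qed
  have fU: "finite (\<Union>(set Ts))" using fin(2) by auto
  have "card (?I (A # Ts)) = card (?I Ts) + card ?L"
    unfolding e
  proof (rule card_Un_disjoint)
    show "finite (?I Ts)" by (rule finite_subset[OF sub]) (use fU in auto)
    show "finite ?L" by (rule finite_subset[of _ "\<Union>(set Ts) \<times> A"]) (use fU fin in auto)
    show "?I Ts \<inter> ?L = {}" using sub dj by blast
  qed
  then show ?thesis by (simp only: tabloid_inv_def ltpairs_def)
qed

text \<open>Prepending a row exchanges even and odd positions, so the two values of
  \<open>part_inv\<close> together count every entry of \<open>lam\<close> once. This converts the
  number of remaining classes into inv(\<lambda>).\<close>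

lemma part_inv_Cons: "even (part_inv (m # lam) + part_inv lam + sum_list lam)"
proof -
  have "part_inv (m # lam) = (\<Sum>r<length lam. if even r then lam ! r else 0)"
    unfolding part_inv_def
    by (auto simp: sum.lessThan_Suc_shift simp del: sum.lessThan_Suc intro!: sum.cong)
  moreover have "sum_list lam = (\<Sum>r<length lam. if even r then lam ! r else 0) + part_inv lam"
    unfolding part_inv_def sum.distrib[symmetric]
    by (auto simp: sum_list_sum_nth atLeast0LessThan intro!: sum.cong)
  ultimately show ?thesis by simp
qed

lemma rho_inv_Cons: "rho_inv (m # lam) (r # rho) = (if odd m then r else 0) + rho_inv lam rho"
  unfolding rho_inv_def
  by (auto simp: sum.lessThan_Suc_shift simp del: sum.lessThan_Suc intro!: sum.cong)

section \<open>Unfolding the algorithm by one step\<close>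

lemma ambc_iter_Suc: "ambc_iter n B (Suc k) = ambc_iter n (fw n B) k"
  by (simp add: ambc_iter_def funpow_swap1)

text \<open>The hypothesis on \<open>k\<close> guarantees that the \<open>LEAST\<close> in
  \<open>ambc_len_def\<close> is attained, and \<open>B\<close> being nonempty excludes index
  0.\<close>

lemma ambc_len_step:
  assumes "B \<noteq> {}" "ambc_iter n (fw n B) k = {}"
  shows "ambc_len n B = Suc (ambc_len n (fw n B))"
  unfolding ambc_len_def ambc_iter_Suc[symmetric]
  by (rule Least_Suc[of _ "Suc k"]) (use assms in \<open>auto simp: ambc_iter_Suc ambc_iter_def[of n B 0]\<close>)

lemma ambc_step:
  assumes "B \<noteq> {}" "ambc_iter n (fw n B) k = {}"
  shows "ambc_P n B = (\<lambda>c. resid n (snd c)) ` backS n B # ambc_P n (fw n B)"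
    "ambc_Q n B = (\<lambda>c. resid n (fst c)) ` backS n B # ambc_Q n (fw n B)"
    "ambc_rho n B = rho_entry n (backS n B) # ambc_rho n (fw n B)"
    "ambc_shape n B = ncls n (backS n B) # ambc_shape n (fw n B)"
  unfolding ambc_P_def ambc_Q_def ambc_rho_def ambc_shape_def ambc_len_step[OF assms] map_upt_Suc
  by (simp_all add: ambc_iter_Suc) (simp_all add: ambc_iter_def)

lemma ambc_empty:
  shows "ambc_P n {} = []" "ambc_Q n {} = []" "ambc_rho n {} = []" "ambc_shape n {} = []"
proof -
  have "ambc_len n {} = 0" unfolding ambc_len_def by (rule Least_eq_0) (simp add: ambc_iter_def)
  then show "ambc_P n {} = []" "ambc_Q n {} = []" "ambc_rho n {} = []" "ambc_shape n {} = []"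
    by (simp_all add: ambc_P_def ambc_Q_def ambc_rho_def ambc_shape_def)
qed

definition ambc_exponent :: "nat \<Rightarrow> ball set \<Rightarrow> int" where
  "ambc_exponent n B = int (tabloid_inv (ambc_P n B)) + int (tabloid_inv (ambc_Q n B))
     + int (part_inv (ambc_shape n B)) + rho_inv (ambc_shape n B) (ambc_rho n B)"

text \<open>The parity claim is bundled with what its step consumes: termination to unfold the
  lists, the residues occupied by the rows to identify the \<open>ltpairs\<close>, and the sum of
  the shape for \<open>part_inv_Cons\<close>.\<close>

lemma ambc_parity:
  assumes "pperm n B"
  shows "(\<exists>k. ambc_iter n B k = {}) \<and> \<Union>(set (ambc_P n B)) = resid n ` snd ` B \<and>
    \<Union>(set (ambc_Q n B)) = resid n ` fst ` B \<and> sum_list (ambc_shape n B) = ncls n B \<and>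
    even (int (inversions (res n ` B)) + rho_entry n B + ambc_exponent n B)"
  using assms
proof (induction "ncls n B" arbitrary: B rule: less_induct)
  case less
  interpret pperm n B by (rule less.prems)
  show ?case
  proof (cases "B = {}")
    case True
    have "ncls n {} = 0" "rho_entry n {} = 0" by (simp_all add: ncls_def rho_entry_def tclasses_def)
    moreover have "\<exists>k. ambc_iter n {} k = {}" by (rule exI[of _ 0]) (simp add: ambc_iter_def)
    ultimately show ?thesis
      unfolding True by (simp add: ambc_empty ambc_exponent_def tabloid_inv_def part_inv_def rho_inv_def)
  next
    case False
    interpret F: pperm n "fw n B" by (rule pperm_fw[OF False])
    have IH: "\<exists>k. ambc_iter n (fw n B) k = {}" "\<Union>(set (ambc_P n (fw n B))) = resid n ` snd ` fw n B"
      "\<Union>(set (ambc_Q n (fw n B))) = resid n ` fst ` fw n B"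
      "sum_list (ambc_shape n (fw n B)) = ncls n (fw n B)"
      "even (int (inversions (res n ` fw n B)) + rho_entry n (fw n B) + ambc_exponent n (fw n B))"
      using less.hyps[OF _ F.pperm_axioms] ncls_fw[OF False] channel_size_pos[OF False] by auto
    obtain k where k: "ambc_iter n (fw n B) k = {}" using IH(1) by blast
    have st: "ambc_P n B = resid n ` snd ` backS n B # ambc_P n (fw n B)"
      "ambc_Q n B = resid n ` fst ` backS n B # ambc_Q n (fw n B)"
      "ambc_rho n B = rho_entry n (backS n B) # ambc_rho n (fw n B)"
      "ambc_shape n B = channel_size # ambc_shape n (fw n B)"
      using ambc_step[OF False k] ncls_backS[OF False] by (simp_all add: image_image)
    have rsub: "resid n ` A \<subseteq> {1..int n}" for A using resid_bounds[OF n_pos] by auto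
    have finr: "finite (resid n ` A)" for A by (rule finite_subset[OF rsub]) simp
    have fin: "finite C" if "C \<in> set (ambc_P n (fw n B)) \<or> C \<in> set (ambc_Q n (fw n B))" for C
    proof -
      have "C \<subseteq> resid n ` snd ` fw n B \<or> C \<subseteq> resid n ` fst ` fw n B"
        using that Union_upper unfolding IH(2,3)[symmetric] by metis
      then show ?thesis using finr finite_subset by metis
    qed
    let ?x = "ltpairs (resid n ` snd ` fw n B) (resid n ` snd ` backS n B)"
    let ?y = "ltpairs (resid n ` fst ` fw n B) (resid n ` fst ` backS n B)"
    have P: "tabloid_inv (ambc_P n B) = tabloid_inv (ambc_P n (fw n B)) + ?x"
      unfolding st(1) IH(2)[symmetric]
      by (rule tabloid_inv_Cons) (use fin finr resid_fw_backS_disjoint(2)[OF False] IH(2) in auto)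
    have Q: "tabloid_inv (ambc_Q n B) = tabloid_inv (ambc_Q n (fw n B)) + ?y"
      unfolding st(2) IH(3)[symmetric]
      by (rule tabloid_inv_Cons) (use fin finr resid_fw_backS_disjoint(1)[OF False] IH(3) in auto)
    let ?rS = "rho_entry n (backS n B)"
    have R: "rho_inv (ambc_shape n B) (ambc_rho n B)
      = (if odd channel_size then ?rS else 0) + rho_inv (ambc_shape n (fw n B)) (ambc_rho n (fw n B))"
      unfolding st(3,4) rho_inv_Cons ..
    have L: "even (int (part_inv (ambc_shape n B)) + int (part_inv (ambc_shape n (fw n B))) + int (ncls n (fw n B)))"
      using part_inv_Cons[of channel_size "ambc_shape n (fw n B)"] unfolding st(4) IH(4) by simp
    have S: "even (int (inversions (res n ` backS n B)) + ?rS + (if odd channel_size then ?rS else 0))"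
      using backS_parity[OF False] by (auto split: if_splits)
    have T: "even (int (inversions (res n ` B)) + int (inversions (res n ` fw n B)) + int (inversions (res n ` backS n B))
      + int ?y + int ?x + int (ncls n (fw n B)))"
      using step_parity[OF False] by presburger
    \<comment> \<open>The sum of the four even quantities is the desired one plus twice
      \<open>f + s + c + l'\<close>. Here \<open>b\<close>, \<open>f\<close>, \<open>s\<close> stand
      for the inversions of \<open>B\<close>, of \<open>fw n B\<close> and of the back
      corners.\<close>
    have *: "even (b + (rf + rs) + ((p + x) + (q + y) + l + (t + u)))"
      if "even (b + f + s + y + x + c)" "even (s + rs + t)" "even (l + l' + c)" "even (f + rf + (p + q + l' + u))"
      for b f s x y c rf rs p q l l' t u :: int
    proof -
      have "even ((b + f + s + y + x + c) + (s + rs + t) + (l + l' + c) + (f + rf + (p + q + l' + u)))"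
        by (rule dvd_add[OF dvd_add[OF dvd_add[OF that(1,2)] that(3)] that(4)])
      moreover have "(b + f + s + y + x + c) + (s + rs + t) + (l + l' + c) + (f + rf + (p + q + l' + u))
        = (b + (rf + rs) + ((p + x) + (q + y) + l + (t + u))) + 2 * (f + s + c + l')" by simp
      ultimately show ?thesis by (metis dvd_add_left_iff dvd_triv_left)
    qed
    have "even (int (inversions (res n ` B)) + rho_entry n B + ambc_exponent n B)"
      unfolding rho_step[OF False] ambc_exponent_def P Q R of_nat_add
      by (rule *[OF T S L IH(5)[unfolded ambc_exponent_def]])
    moreover have "\<exists>k. ambc_iter n B k = {}" using k ambc_iter_Suc by metis
    moreover have "\<Union>(set (ambc_P n B)) = resid n ` snd ` B" "\<Union>(set (ambc_Q n B)) = resid n ` fst ` B"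
      using fw_images[OF False] IH(2,3) st(1,2) by simp_all
    moreover have "sum_list (ambc_shape n B) = ncls n B" using st(4) IH(4) ncls_fw[OF False] by simp
    ultimately show ?thesis by blast
  qed
qed

section \<open>Affine permutations and the final count\<close>

locale affine =
  fixes n :: nat and w :: "int \<Rightarrow> int"
  assumes n_pos: "n \<ge> 1" and w: "affine_perm n w"
begin

lemma w_tshift: "w (i + k * int n) = w i + k * int n"
proof (induction k rule: int_induct[where k = 0])
  case (step1 k)
  have "w ((i + k * int n) + int n) = w (i + k * int n) + int n" using w by (simp add: affine_perm_def)
  then show ?case using step1 by (simp add: algebra_simps)
next
  case (step2 k)
  have "w ((i + (k - 1) * int n) + int n) = w (i + (k - 1) * int n) + int n" using w by (simp add: affine_perm_def)
  then show ?case using step2 by (simp add: algebra_simps)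
qed simp

lemma in_balls: "b \<in> balls w \<longleftrightarrow> snd b = w (fst b)"
  by (cases b) (auto simp: balls_def)

lemma pperm_balls: "pperm n (balls w)"
proof
  show "tinv n (balls w)" by (simp add: tinv_def in_balls w_tshift)
  show "inj_on fst (balls w)" by (auto simp: inj_on_def balls_def)
  have "inj w" using w by (simp add: affine_perm_def bij_def)
  then show "inj_on snd (balls w)" by (auto simp: inj_on_def balls_def)
qed (rule n_pos)

sublocale pperm n "balls w"
  by (rule pperm_balls)

lemma win_balls: "win n (balls w) = (\<lambda>i. (i, w i)) ` {1..int n}"
  by (auto simp: win_def balls_def)

text \<open>Translating the first ball of a pair into the window picks one pair per class
  (\<open>T\<close>). The second ball is then a translate of a unique window ball.\<close>

lemma aff_length_eq: "aff_length n w = affine_inversions"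
proof -
  let ?W = "win n (balls w)"
  define X where "X = {(a, b). a \<in> balls w \<and> b \<in> balls w \<and> sNE a b}"
  define T where "T = {(a, b) \<in> X. a \<in> ?W}"
  note tw = transversal_win[OF n_pos tinv_B]
  have "transversal (tshift2 n) X T"
    unfolding transversal_def
  proof (intro conjI ballI allI impI)
    fix x assume "x \<in> X"
    then obtain a b where x: "x = (a, b)" "a \<in> balls w" "b \<in> balls w" "sNE a b" by (auto simp: X_def)
    obtain k where "tshift n k a \<in> ?W" using tw x(2) unfolding transversal_def by blast
    then have "tshift2 n k x \<in> T" using x tshift_in by (auto simp: T_def X_def tshift2_def sNE_def)
    then show "\<exists>k. tshift2 n k x \<in> T" ..
  next
    fix x k assume "x \<in> T" "tshift2 n k x \<in> T"
    then obtain a b where x: "x = (a, b)" "a \<in> ?W" "tshift n k a \<in> ?W" by (auto simp: T_def tshift2_def)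
    then have "tshift n k a = a" using tw unfolding transversal_def by blast
    then have "k = 0" using n_pos by (auto simp: tshift_def prod_eq_iff)
    then show "tshift2 n k x = x" by (simp add: tshift2_def)
  qed (auto simp: T_def)
  then have "bij_betw (\<lambda>x. {y \<in> X. \<exists>k. y = tshift2 n k x}) T (tclasses (tshift2 n) X)"
    by (rule transversal_bij_tclasses[rotated 2]) (auto simp: tshift2_def)
  then have len: "aff_length n w = card T"
    unfolding aff_length_def X_def[symmetric] by (rule bij_betw_same_card[symmetric])
  define K where "K = (\<lambda>a b. {k. sNE a (tshift n k b)})"
  have finK: "finite (K a b)" for a b
  proof (rule finite_subset)
    \<comment> \<open>A crude range, valid because the absolute value of \<open>k\<close> is at most
      that of \<open>k * n\<close>. Finiteness is needed for the cardinality of \<open>?S\<close> to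
      be the sum of the cardinalities.\<close>
    show "K a b \<subseteq> {- \<bar>fst a\<bar> - \<bar>fst b\<bar> .. \<bar>snd a\<bar> + \<bar>snd b\<bar>}"
    proof
      fix k assume "k \<in> K a b"
      then have k: "fst a < fst b + k * int n" "snd b + k * int n < snd a" by (auto simp: K_def sNE_def)
      have "- \<bar>fst a\<bar> - \<bar>fst b\<bar> \<le> k"
      proof (cases "k \<ge> 0")
        case False
        then have "k * int n \<le> k * 1" using n_pos by (intro mult_left_mono_neg) auto
        then show ?thesis using k by linarith
      qed linarith
      moreover have "k \<le> \<bar>snd a\<bar> + \<bar>snd b\<bar>"
      proof (cases "k \<le> 0")
        case False
        then have "k * 1 \<le> k * int n" using n_pos by (intro mult_left_mono) auto
        then show ?thesis using k by linarith
      qed linarith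
      ultimately show "k \<in> {- \<bar>fst a\<bar> - \<bar>fst b\<bar> .. \<bar>snd a\<bar> + \<bar>snd b\<bar>}" by simp
    qed
  qed simp
  let ?S = "SIGMA a:?W. SIGMA b:?W. K a b"
  have "bij_betw (\<lambda>(a, b, k). (a, tshift n k b)) ?S T"
  proof (rule bij_betw_imageI)
    show "inj_on (\<lambda>(a, b, k). (a, tshift n k b)) ?S"
    proof (rule inj_onI)
      fix x y assume x: "x \<in> ?S" and y: "y \<in> ?S"
        and eq: "(\<lambda>(a, b, k). (a, tshift n k b)) x = (\<lambda>(a, b, k). (a, tshift n k b)) y"
      obtain a b k where x': "x = (a, b, k)" "b \<in> ?W" using x by blast
      obtain a' b' k' where y': "y = (a', b', k')" "b' \<in> ?W" using y by blast
      have e: "a = a'" "tshift n k b = tshift n k' b'" using eq x' y' by auto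
      have b': "b' = tshift n (k - k') b"
        using arg_cong[OF e(2), of "tshift n (- k')"] by simp
      then have "b' = b" using tw x' y' unfolding transversal_def by blast
      then have "k = k'" using b' n_pos by (auto simp: tshift_def prod_eq_iff)
      then show "x = y" using x' y' e \<open>b' = b\<close> by simp
    qed
    show "(\<lambda>(a, b, k). (a, tshift n k b)) ` ?S = T"
    proof (intro set_eqI iffI)
      fix x assume "x \<in> (\<lambda>(a, b, k). (a, tshift n k b)) ` ?S"
      then obtain a b k where "x = (a, tshift n k b)" "a \<in> ?W" "b \<in> ?W" "k \<in> K a b" by auto
      then show "x \<in> T" using tshift_in[of b k] by (auto simp: T_def X_def K_def win_def)
    next
      fix x assume "x \<in> T"
      then obtain a b where x: "x = (a, b)" "a \<in> ?W" "b \<in> balls w" "sNE a b" by (auto simp: T_def X_def)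
      obtain k where k: "tshift n k b \<in> ?W" using tw x(3) unfolding transversal_def by blast
      then have "(a, tshift n k b, - k) \<in> ?S" using x by (auto simp: K_def)
      then show "x \<in> (\<lambda>(a, b, k). (a, tshift n k b)) ` ?S"
        by (rule image_eqI[rotated]) (simp add: x)
    qed
  qed
  then have "card T = card ?S" by (rule bij_betw_same_card[symmetric])
  also have "\<dots> = (\<Sum>a\<in>?W. \<Sum>b\<in>?W. card (K a b))"
    using finK finite_win[OF subset_refl] by simp
  finally show ?thesis using len by (simp add: affine_inversions_def K_def)
qed

lemma ncls_balls: "ncls n (balls w) = n"
proof -
  have "inj_on (\<lambda>i. (i, w i)) {1..int n}" by (auto simp: inj_on_def)
  then show ?thesis by (simp add: ncls_win[OF n_pos tinv_B] win_balls card_image)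
qed

text \<open>\<open>w\<close> permutes the residues, so their sum cancels against that of 1 to n, and
  only the blocks remain, each weighing n.\<close>

lemma sum_displacement: "(\<Sum>i=1..int n. w i - i) = int n * rho_entry n (balls w)"
proof -
  have inj: "inj_on (\<lambda>i. (i, w i)) {1..int n}" by (auto simp: inj_on_def)
  have c1: "ceil_div n i = 1" if "i \<in> {1..int n}" for i
    using that n_pos by (simp add: ceil_div_eq div_pos_pos_trivial)
  have rho: "rho_entry n (balls w) = (\<Sum>i=1..int n. ceil_div n (w i) - 1)"
    unfolding rho_entry_transversal[OF n_pos transversal_win[OF n_pos tinv_B]] win_balls
    by (subst sum.reindex[OF inj]) (auto intro!: sum.cong simp: c1)
  have "inj_on (\<lambda>b. resid n (snd b)) ((\<lambda>i. (i, w i)) ` {1..int n})"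
    using transversal_inj(2)[OF transversal_win[OF n_pos tinv_B]] unfolding win_balls .
  then have injr: "inj_on (\<lambda>i. resid n (w i)) {1..int n}"
    using comp_inj_on[OF inj, of "\<lambda>b. resid n (snd b)"] by (simp add: comp_def)
  have "(\<lambda>i. resid n (w i)) ` {1..int n} = {1..int n}"
    by (rule endo_inj_surj[OF _ _ injr]) (use resid_bounds[OF n_pos] in auto)
  then have sr: "(\<Sum>i=1..int n. resid n (w i)) = (\<Sum>i=1..int n. i)"
    using sum.reindex[OF injr, of "\<lambda>x. x"] by (simp add: comp_def)
  have "(\<Sum>i=1..int n. w i) = (\<Sum>i=1..int n. (ceil_div n (w i) - 1) * int n + resid n (w i))"
    by (rule sum.cong[OF refl]) (rule ceil_div_resid[OF n_pos])
  also have "\<dots> = (\<Sum>i=1..int n. ceil_div n (w i) - 1) * int n + (\<Sum>i=1..int n. i)"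
    unfolding sum.distrib sum_distrib_right[symmetric] sr ..
  finally show ?thesis unfolding rho sum_subtractf[of w] by (simp add: mult.commute)
qed

text \<open>On adding the two parity statements for \<open>balls w\<close>, the inversions of
  residues occur twice, and \<open>(n - 1) * ?r + ?r\<close> is the total displacement.\<close>

lemma sign_parity:
  "even (int (aff_length n w) + (\<Sum>i=1..int n. w i - i) + ambc_exponent n (balls w))"
proof -
  let ?r = "rho_entry n (balls w)" and ?i = "int (inversions (res n ` balls w))"
  have 1: "even (int (aff_length n w) + ?i + (int n - 1) * ?r)"
    using affine_inversions_parity unfolding aff_length_eq ncls_balls .
  have 2: "even (?i + ?r + ambc_exponent n (balls w))"
    using ambc_parity[OF pperm_balls] by blast
  have "even ((int (aff_length n w) + ?i + (int n - 1) * ?r) + (?i + ?r + ambc_exponent n (balls w)))"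
    using 1 2 by (rule dvd_add)
  also have "(int (aff_length n w) + ?i + (int n - 1) * ?r) + (?i + ?r + ambc_exponent n (balls w))
    = (int (aff_length n w) + int n * ?r + ambc_exponent n (balls w)) + 2 * ?i"
    by (simp add: algebra_simps)
  finally show ?thesis unfolding sum_displacement by simp
qed

end

theorem theorem4p4:
  fixes n :: nat and w :: "int \<Rightarrow> int"
  assumes "n \<ge> 1" and "affine_perm n w"
  shows "(-1::real) ^ aff_length n w * (-1::real) powi (\<Sum>i=1..int n. w i - i) =
    (-1::real) powi (int (tabloid_inv (ambc_P n (balls w))) + int (tabloid_inv (ambc_Q n (balls w)))
       + int (part_inv (ambc_shape n (balls w)))
       + rho_inv (ambc_shape n (balls w)) (ambc_rho n (balls w)))"
proof -
  interpret affine n w by unfold_locales (use assms in auto)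
  have powi: "(-1::real) powi k = (if even k then 1 else - 1)" for k
    by (simp add: power_int_minus_left)
  have "(-1::real) ^ aff_length n w = (-1) powi int (aff_length n w)" by simp
  then show ?thesis
    using sign_parity unfolding ambc_exponent_def[symmetric] powi
    by (auto split: if_splits)
qed

end
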